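(* There exists a constant $C>0$ such that for every odd $n$, if $G$ is a dense random circulant graph on $n$ vertices, then $$\sqrt{n}\;\le\;\mathbb{E}\,\vartheta(G)\;\le\; C\sqrt{n\log\log n}.$$
   Context: Vertices are indexed by $[n]=\{0,1,\dots,n-1\}$. For a graph $G$ on vertex set $[n]$, the Lovász theta number is $$\vartheta(G)=\max_{X\in\mathbb{R}^{n\times n}}\Big\{\langle X,J\rangle \;:\; X\succeq 0,\ \operatorname{Tr}X=1,\ X_{ij}=0 \text{ for all edges } (i,j)\in E(G)\Big\},$$ where $J$ is the all-ones matrix and $\langle X,J\rangle=\sum_{i,j}X_{ij}$. Dense random circulant graph: for odd $n$, let $m=\frac{n-1}{2}$, sample $x\in\{0,1\}^m$ uniformly at random, and define the row vector $R=(0\ \ x\ \ \overleftarrow{x})\in\{0,1\}^n$, where $\overleftarrow{x}_i=x_{m-i-1}$ (so $R_0=0$ and $R_k=R_{n-k}$ for $1\le k\le n-1$). The graph $G$ has vertex set $[n]$, and distinct vertices $i,j$ are adjacent iff $R_{(j-i)\bmod n}=1$; i.e. the adjacency matrix is the circulant matrix with first row $R$.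
   Formalization: The upper bound is stated only for odd n ≥ 3, since log log n is undefined at n = 1; the lower bound is proved for every odd n, including n = 1, and log is the natural logarithm. *)

theory Defs
  imports "HOL-Probability.Probability" "Jordan_Normal_Form.Matrix"
begin

text \<open>A graph on the vertex set \<open>{0..<n}\<close> is given by its symmetric set of edges \<open>(i, j)\<close>.\<close>

definition psd_mat :: "nat \<Rightarrow> real mat \<Rightarrow> bool" where
  "psd_mat n X \<longleftrightarrow> X \<in> carrier_mat n n \<and> transpose_mat X = X \<and>
     (\<forall>v \<in> carrier_vec n. 0 \<le> scalar_prod v (X *\<^sub>v v))"

definition theta_feasible :: "nat \<Rightarrow> (nat \<times> nat) set \<Rightarrow> real mat set" where
  "theta_feasible n E = {X. psd_mat n X \<and> (\<Sum>i<n. X $$ (i, i)) = 1 \<and>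
     (\<forall>(i, j) \<in> E. X $$ (i, j) = 0)}"

text \<open>The supremum is a maximum for every loopless graph on \<open>{0..<n}\<close> with \<open>n > 0\<close>; see
  \<open>lovasz_theta_is_max\<close> below.\<close>

definition lovasz_theta :: "nat \<Rightarrow> (nat \<times> nat) set \<Rightarrow> real" where
  "lovasz_theta n E = (SUP X \<in> theta_feasible n E. \<Sum>i<n. \<Sum>j<n. X $$ (i, j))"

definition circulant_row :: "nat list \<Rightarrow> nat list" where
  "circulant_row x = 0 # x @ rev x"

text \<open>For \<open>i < n\<close> the natural number \<open>j + n - i\<close> is congruent to the integer \<open>j - i\<close>
  modulo \<open>n\<close>.\<close>

definition circulant_edges :: "nat \<Rightarrow> nat list \<Rightarrow> (nat \<times> nat) set" where
  "circulant_edges n R = {(i, j). i < n \<and> j < n \<and> i \<noteq> j \<and> R ! ((j + n - i) mod n) = 1}"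

text \<open>Intended for odd \<open>n\<close>: then \<open>circulant_row x\<close> has length \<open>n\<close>.\<close>

definition dense_random_circulant :: "nat \<Rightarrow> (nat \<times> nat) set pmf" where
  "dense_random_circulant n =
     map_pmf (\<lambda>x. circulant_edges n (circulant_row x))
       (pmf_of_set {x. set x \<subseteq> {0, 1} \<and> length x = (n - 1) div 2})"

lemma quadratic_form_sum:
  assumes "X \<in> carrier_mat n n" "v \<in> carrier_vec n"
  shows "scalar_prod v (X *\<^sub>v v) = (\<Sum>i<n. \<Sum>j<n. vec_index v i * X $$ (i, j) * vec_index v j)"
  using assms
  by (auto simp: scalar_prod_def sum_distrib_left atLeast0LessThan mult.assoc intro!: sum.cong)

lemma psd_mat_iff:
  "psd_mat n X \<longleftrightarrow> X \<in> carrier_mat n n \<and> (\<forall>i<n. \<forall>j<n. X $$ (i, j) = X $$ (j, i)) \<and>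
     (\<forall>f. 0 \<le> (\<Sum>i<n. \<Sum>j<n. f i * X $$ (i, j) * f j))" (is "?l \<longleftrightarrow> ?r")
proof
  assume l: ?l
  then have X: "X \<in> carrier_mat n n" and t: "transpose_mat X = X" by (auto simp: psd_mat_def)
  have s: "X $$ (i, j) = X $$ (j, i)" if "i < n" "j < n" for i j
  proof -
    have "X $$ (i, j) = transpose_mat X $$ (i, j)" using t by simp
    also have "\<dots> = X $$ (j, i)" using X that by auto
    finally show ?thesis .
  qed
  have "0 \<le> (\<Sum>i<n. \<Sum>j<n. f i * X $$ (i, j) * f j)" for f
  proof -
    have "0 \<le> scalar_prod (vec n f) (X *\<^sub>v vec n f)" using l by (auto simp: psd_mat_def)
    then show ?thesis using quadratic_form_sum[OF X, of "vec n f"] by simp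
  qed
  with X s show ?r by blast
next
  assume ?r
  then show ?l unfolding psd_mat_def
    by (auto simp: quadratic_form_sum intro!: eq_matI)
qed

lemma psd_mat_entry_bound:
  assumes X: "psd_mat n X" and tr: "(\<Sum>i<n. X $$ (i, i)) = 1" and ij: "i < n" "j < n"
  shows "\<bar>X $$ (i, j)\<bar> \<le> 1"
proof -
  have q: "0 \<le> (\<Sum>i<n. \<Sum>j<n. f i * X $$ (i, j) * f j)" for f
    using X by (simp add: psd_mat_iff)
  have sym: "X $$ (i, j) = X $$ (j, i)" using X ij by (simp add: psd_mat_iff)
  have d0: "0 \<le> X $$ (k, k)" if "k < n" for k
    using q[of "\<lambda>a. if a = k then 1 else 0"] that
    by (simp add: if_distrib[of "\<lambda>x. x * _"] if_distrib[of "\<lambda>x. _ * x"] sum.delta cong: if_cong)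
  have d1: "(\<Sum>k\<in>A. X $$ (k, k)) \<le> 1" if "A \<subseteq> {..<n}" for A
    using sum_mono2[of "{..<n}" A "\<lambda>k. X $$ (k, k)"] that d0 tr by auto
  show ?thesis
  proof (cases "i = j")
    case True
    with d0[of i] d1[of "{i}"] ij show ?thesis by auto
  next
    case False
    have e: "(\<Sum>a<n. \<Sum>b<n. f a * X $$ (a, b) * f b) =
        X $$ (i, i) + c * X $$ (i, j) + c * X $$ (j, i) + c * c * X $$ (j, j)"
      if f: "f = (\<lambda>a. if a = i then 1 else if a = j then c else 0)" for f and c :: real
    proof -
      have z: "(\<Sum>b<n. g b * f b) = g i + c * g j" for g
      proof -
        have "(\<Sum>b<n. g b * f b) = (\<Sum>b\<in>{i, j}. g b * f b)"
          using ij f by (intro sum.mono_neutral_right) auto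
        then show ?thesis using False f by simp
      qed
      have "(\<Sum>a<n. \<Sum>b<n. f a * X $$ (a, b) * f b) =
          (\<Sum>a<n. (\<Sum>b<n. X $$ (a, b) * f b) * f a)"
        by (simp add: sum_distrib_right sum_distrib_left mult_ac)
      also have "\<dots> = X $$ (i, i) + c * X $$ (i, j) + c * X $$ (j, i) + c * c * X $$ (j, j)"
        unfolding z by (simp add: algebra_simps)
      finally show ?thesis .
    qed
    have le1: "X $$ (i, i) + X $$ (j, j) \<le> 1" using d1[of "{i, j}"] ij False by simp
    have "0 \<le> X $$ (i, i) + c * X $$ (i, j) + c * X $$ (j, i) + c * c * X $$ (j, j)" for c
      unfolding e[OF refl, symmetric] by (rule q)
    from this[of 1] this[of "-1"]
    have "0 \<le> X $$ (i, i) + X $$ (i, j) + X $$ (j, i) + X $$ (j, j)"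
      "0 \<le> X $$ (i, i) - X $$ (i, j) - X $$ (j, i) + X $$ (j, j)" by simp_all
    then show ?thesis using sym le1 by simp
  qed
qed

lemma lovasz_theta_is_max:
  assumes n: "0 < n" and E: "E \<subseteq> {..<n} \<times> {..<n}" "irrefl E"
  shows "\<exists>X \<in> theta_feasible n E. lovasz_theta n E = (\<Sum>i<n. \<Sum>j<n. X $$ (i, j)) \<and>
    (\<forall>Y \<in> theta_feasible n E. (\<Sum>i<n. \<Sum>j<n. Y $$ (i, j)) \<le> (\<Sum>i<n. \<Sum>j<n. X $$ (i, j)))"
proof -
  define obj where "obj = (\<lambda>f :: nat \<times> nat \<Rightarrow> real. \<Sum>i<n. \<Sum>j<n. f (i, j))"
  define B where "B = Pi\<^sub>E UNIV (\<lambda>p. if p \<in> {..<n} \<times> {..<n} then {-1..1::real} else {0})"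
  define S where "S = {f :: nat \<times> nat \<Rightarrow> real. \<forall>i<n. \<forall>j<n. f (i, j) = f (j, i)}"
  define Q where "Q = {f :: nat \<times> nat \<Rightarrow> real. \<forall>g. 0 \<le> (\<Sum>i<n. \<Sum>j<n. g i * f (i, j) * g j)}"
  define T where "T = {f :: nat \<times> nat \<Rightarrow> real. (\<Sum>i<n. f (i, i)) = 1}"
  define Z where "Z = {f :: nat \<times> nat \<Rightarrow> real. \<forall>(i, j) \<in> E. f (i, j) = 0}"
  let ?K = "B \<inter> (S \<inter> Q \<inter> T \<inter> Z)"
  have comp: "compact B"
  proof -
    have "compactin (product_topology (\<lambda>_. euclidean) UNIV) B"
      unfolding B_def by (subst compactin_PiE) auto
    then show ?thesis by (simp add: euclidean_product_topology)
  qed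
  have coord: "continuous_on A (\<lambda>f :: nat \<times> nat \<Rightarrow> real. f p)" for A p
    by (rule continuous_on_subset[OF continuous_on_product_coordinates]) simp
  have "closed S" unfolding S_def
    by (intro closed_Collect_all closed_Collect_imp open_Collect_const closed_Collect_eq coord)
  moreover have "closed Q" unfolding Q_def
    by (intro closed_Collect_all closed_Collect_le continuous_on_const continuous_on_sum
        continuous_on_mult coord)
  moreover have "closed T" unfolding T_def
    by (intro closed_Collect_eq continuous_on_const continuous_on_sum coord)
  moreover have "closed Z" unfolding Z_def case_prod_unfold Ball_def
    by (intro closed_Collect_all closed_Collect_imp open_Collect_const closed_Collect_eq
        continuous_on_const coord)
  ultimately have cl: "closed S" "closed Q" "closed T" "closed Z" by blast+
  have compK: "compact ?K" using comp cl by (intro compact_Int_closed closed_Int) auto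
  have to_feasible: "mat n n f \<in> theta_feasible n E" if "f \<in> ?K" for f
    using that E
    by (auto simp: theta_feasible_def psd_mat_iff S_def Q_def T_def Z_def)
  have obj_mat: "(\<Sum>i<n. \<Sum>j<n. mat n n f $$ (i, j)) = obj f" for f by (simp add: obj_def)
  have of_feasible: "\<exists>f \<in> ?K. (\<Sum>i<n. \<Sum>j<n. Y $$ (i, j)) = obj f" if Y: "Y \<in> theta_feasible n E" for Y
  proof -
    define f where "f = (\<lambda>(i, j). if i < n \<and> j < n then Y $$ (i, j) else 0)"
    have "\<bar>Y $$ (i, j)\<bar> \<le> 1" if "i < n" "j < n" for i j
      using Y that psd_mat_entry_bound by (auto simp: theta_feasible_def)
    then have "f \<in> B" by (auto simp: B_def f_def abs_le_iff minus_le_iff)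
    moreover have "f \<in> S \<inter> Q \<inter> T \<inter> Z"
      using Y E by (auto simp: theta_feasible_def psd_mat_iff S_def Q_def T_def Z_def f_def)
    moreover have "(\<Sum>i<n. \<Sum>j<n. Y $$ (i, j)) = obj f" by (simp add: obj_def f_def)
    ultimately show ?thesis by blast
  qed
  define D where "D = mat n n (\<lambda>(i, j). if i = j then 1 / real n else 0)"
  have "0 \<le> (\<Sum>i<n. \<Sum>j<n. g i * D $$ (i, j) * g j)" for g
  proof (intro sum_nonneg)
    fix i j assume "i \<in> {..<n}" "j \<in> {..<n}"
    then show "0 \<le> g i * D $$ (i, j) * g j" by (auto simp: D_def)
  qed
  moreover have "D $$ (i, j) = 0" if "(i, j) \<in> E" for i j
  proof -
    have "i < n" "j < n" "i \<noteq> j" using that E by (auto simp: irrefl_def)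
    then show ?thesis by (simp add: D_def)
  qed
  ultimately have "D \<in> theta_feasible n E"
    using n by (auto simp: theta_feasible_def psd_mat_iff D_def)
  then have "?K \<noteq> {}" using of_feasible by blast
  moreover have "continuous_on ?K obj" unfolding obj_def
    by (intro continuous_on_sum coord)
  ultimately obtain f where f: "f \<in> ?K" "\<forall>g \<in> ?K. obj g \<le> obj f"
    using continuous_attains_sup[OF compK] by blast
  have max: "\<forall>Y \<in> theta_feasible n E. (\<Sum>i<n. \<Sum>j<n. Y $$ (i, j)) \<le> (\<Sum>i<n. \<Sum>j<n. mat n n f $$ (i, j))"
    using of_feasible f(2) unfolding obj_mat by (metis (no_types, lifting))
  have "lovasz_theta n E = (\<Sum>i<n. \<Sum>j<n. mat n n f $$ (i, j))"
    unfolding lovasz_theta_def using to_feasible[OF f(1)] max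
    by (intro cSup_eq_maximum) (blast, fast)
  with to_feasible[OF f(1)] max show ?thesis by blast
qed

end

theory Submission
  imports Defs "HOL-Probability.Hoeffding"
begin

text \<open>
  For a circulant graph the theta number is a linear program over the spectrum: maximise
  \<open>n * lam 0\<close> over probability vectors \<open>lam\<close> on the residues modulo \<open>n\<close> whose cosine transform
  vanishes on the connection set \<open>S\<close>.

  Lower bound: the duals of this program are feasible for the complementary connection set, so the
  theta numbers of \<open>S\<close> and of its complement have product at least \<open>n\<close>. Both sets have the same
  distribution, and the arithmetic-geometric mean inequality finishes.

  Upper bound: let \<open>e k\<close> be \<open>1\<close> on \<open>S\<close> and \<open>-1\<close> off \<open>S\<close>. Feasibility reads \<open>c k = - e k * c k\<close> for
  the transform \<open>c\<close> of \<open>lam\<close>, so \<open>n * lam 0\<close> is the \<open>lam\<close>-average of minus a random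
  trigonometric sum with coefficients \<open>e k\<close>. Split the frequencies into dyadic blocks
  \<open>{q..<2 * q}\<close>. The part of a block sum above \<open>T * sqrt q\<close> has square norm about
  \<open>n * q * exp (- T^2 / 2)\<close>. Its \<open>lam\<close>-average is dominated by that of its convolution with a
  nonnegative kernel whose spectrum avoids the block: the squared modulus of the transform of a set
  \<open>A\<close> of positive density, none of whose differences lies in the block. Applying
  \<open>c k = - e k * c k\<close> once more turns this into a random sum with signs independent of
  the block, so a union bound over \<open>n\<close> points costs only a factor \<open>sqrt (ln n)\<close>, which
  \<open>T^2\<close> of order \<open>ln (ln n)\<close> absorbs. The block scales \<open>sqrt q\<close> add up geometrically to
  \<open>O(sqrt n)\<close>.
\<close>

section \<open>Cosine sums\<close>

definition cw :: "nat \<Rightarrow> int \<Rightarrow> real" where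
  "cw n x = cos (2 * pi * real_of_int x / real n)"

definition sw :: "nat \<Rightarrow> int \<Rightarrow> real" where
  "sw n x = sin (2 * pi * real_of_int x / real n)"

lemma cw_0 [simp]: "cw n 0 = 1"
  by (simp add: cw_def)

lemma cw_minus [simp]: "cw n (- x) = cw n x"
  by (simp add: cw_def)

lemma abs_cw_le_1: "\<bar>cw n x\<bar> \<le> 1"
  by (simp add: cw_def)

lemma cw_diff: "cw n (x - y) = cw n x * cw n y + sw n x * sw n y"
  by (simp add: cw_def sw_def right_diff_distrib diff_divide_distrib cos_diff)

lemma cw_add: "cw n (x + y) = cw n x * cw n y - sw n x * sw n y"
  by (simp add: cw_def sw_def distrib_left add_divide_distrib cos_add)

lemma cw_mult_cw: "cw n x * cw n y = (cw n (x - y) + cw n (x + y)) / 2"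
  by (simp add: cw_diff cw_add)

lemma cw_eqI:
  assumes "int n dvd x - y"
  shows "cw n x = cw n y"
proof (cases "n = 0")
  case False
  from assms obtain z where "x = y + int n * z"
    by (metis add_diff_cancel_left' diff_add_cancel dvdE add.commute)
  then have "2 * pi * real_of_int x / real n = 2 * pi * real_of_int y / real n + 2 * pi * real_of_int z"
    using False by (simp add: field_simps)
  then show ?thesis
    by (simp add: cw_def cos_add)
qed (use assms in simp)

lemma sum_cis_powers:
  assumes n: "0 < n"
  shows "(\<Sum>j<n. cis (2 * pi * real_of_int d / real n) ^ j) = (if int n dvd d then of_nat n else 0)"
proof -
  define z where "z = cis (2 * pi * real_of_int d / real n)"
  have "z ^ n = cis (2 * pi * real_of_int d)"
    using n by (simp add: z_def Complex.DeMoivre)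
  then have zn: "z ^ n = 1"
    by (simp add: cis_multiple_2pi)
  have "z = 1 \<longleftrightarrow> int n dvd d"
  proof
    assume "z = 1"
    then have "cos (2 * pi * real_of_int d / real n) = 1"
      by (simp add: z_def complex_eq_iff)
    then obtain k where "2 * pi * real_of_int d / real n = of_int k * 2 * pi"
      by (auto simp: cos_one_2pi_int)
    then have "real_of_int d = real_of_int (int n * k)"
      using n by (simp add: field_simps)
    then show "int n dvd d"
      by (metis dvd_triv_left of_int_eq_iff)
  next
    assume "int n dvd d"
    then obtain k where "d = int n * k" by blast
    then have "2 * pi * real_of_int d / real n = 2 * pi * real_of_int k"
      using n by simp
    then show "z = 1"
      by (simp add: z_def cis_multiple_2pi)
  qed
  moreover have "(\<Sum>j<n. z ^ j) = 0" if "z \<noteq> 1"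
    using geometric_sum[OF that, of n] zn by simp
  ultimately show ?thesis
    unfolding z_def by auto
qed

lemma sum_cw:
  assumes n: "0 < n"
  shows "(\<Sum>j<n. cw n (int j * d)) = (if int n dvd d then real n else 0)"
  using arg_cong[OF sum_cis_powers[OF n, of d], of Re]
  by (simp add: Complex.DeMoivre cw_def mult_ac split: if_splits)

lemma sum_sw:
  assumes n: "0 < n"
  shows "(\<Sum>j<n. sw n (int j * d)) = 0"
  using arg_cong[OF sum_cis_powers[OF n, of d], of Im]
  by (simp add: Complex.DeMoivre sw_def mult_ac split: if_splits)

lemma dvd_diff_less_iff:
  assumes "i < n" "l < n"
  shows "int n dvd int l - int i \<longleftrightarrow> l = i"
proof
  assume "int n dvd int l - int i"
  then have "int l mod int n = int i mod int n"
    by (simp add: mod_eq_dvd_iff)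
  then show "l = i"
    using assms by simp
qed simp

lemma sum_rotate:
  "(\<Sum>a\<in>A. \<Sum>b\<in>B. \<Sum>c\<in>C. f a b c) = (\<Sum>b\<in>B. \<Sum>c\<in>C. \<Sum>a\<in>A. f a b c)"
  by (rule trans[OF sum.swap]) (intro sum.cong refl sum.swap)

lemma sum_cw_mult_cw:
  assumes "0 < n"
  shows "(\<Sum>j<n. cw n (int j * a) * cw n (int j * b)) =
    real n / 2 * (of_bool (int n dvd a - b) + of_bool (int n dvd a + b))"
proof -
  have "(\<Sum>j<n. cw n (int j * a) * cw n (int j * b)) =
      ((\<Sum>j<n. cw n (int j * (a - b))) + (\<Sum>j<n. cw n (int j * (a + b)))) / 2"
    by (simp add: cw_mult_cw sum.distrib algebra_simps flip: sum_divide_distrib)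
  then show ?thesis
    unfolding sum_cw[OF assms] by (cases "int n dvd a - b"; cases "int n dvd a + b") simp_all
qed

text \<open>The left side is the squared modulus of a sum of unit complex numbers with weights
  \<open>f\<close>; the right side splits it into real and imaginary part. The nonnegative kernels
  below come from here.\<close>

lemma quadratic_form_cw:
  "(\<Sum>i\<in>I. \<Sum>l\<in>I. f i * f l * cw n (p l - p i)) =
    (\<Sum>i\<in>I. f i * cw n (p i))\<^sup>2 + (\<Sum>i\<in>I. f i * sw n (p i))\<^sup>2"
  by (simp add: cw_diff power2_eq_square sum_product sum.distrib[symmetric] algebra_simps)

lemma quadratic_form_cw_nonneg:
  "0 \<le> (\<Sum>i\<in>I. \<Sum>l\<in>I. f i * f l * cw n (p l - p i))"
  by (simp add: quadratic_form_cw)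

text \<open>Parseval for the complex transform, of which only the cosine part is kept; hence an
  inequality.\<close>

lemma cw_bessel:
  assumes n: "0 < n"
  shows "(\<Sum>k<n. (\<Sum>l<n. u l * cw n (int l * int k))\<^sup>2) \<le> real n * (\<Sum>l<n. (u l)\<^sup>2)"
proof -
  have "(\<Sum>k<n. (\<Sum>l<n. u l * cw n (int l * int k))\<^sup>2)
      \<le> (\<Sum>k<n. \<Sum>i<n. \<Sum>l<n. u i * u l * cw n (int l * int k - int i * int k))"
    by (intro sum_mono) (simp add: quadratic_form_cw)
  also have "\<dots> = (\<Sum>i<n. \<Sum>l<n. u i * u l * (\<Sum>k<n. cw n (int k * (int l - int i))))"
    by (subst sum_rotate) (simp add: sum_distrib_left algebra_simps)
  also have "\<dots> = (\<Sum>i<n. \<Sum>l<n. if l = i then u i * u l * real n else 0)"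
  proof (intro sum.cong refl)
    fix i l assume "i \<in> {..<n}" "l \<in> {..<n}"
    then have "int n dvd int l - int i \<longleftrightarrow> l = i"
      by (simp add: dvd_diff_less_iff)
    then show "u i * u l * (\<Sum>k<n. cw n (int k * (int l - int i))) = (if l = i then u i * u l * real n else 0)"
      by (simp add: sum_cw[OF n])
  qed
  also have "\<dots> = real n * (\<Sum>l<n. (u l)\<^sup>2)"
    by (simp add: sum_distrib_left power2_eq_square mult_ac)
  finally show ?thesis .
qed

section \<open>The spectral linear program\<close>

text \<open>Connection sets will be subsets of \<open>{1..m}\<close>, with one representative for
  each pair \<open>k\<close>, \<open>n - k\<close>. Integer divisibility avoids truncated
  subtraction.\<close>

definition circ_graph :: "nat \<Rightarrow> nat set \<Rightarrow> (nat \<times> nat) set" where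
  "circ_graph n S = {(i, j). i < n \<and> j < n \<and>
     (\<exists>k\<in>S. int n dvd int j - int i - int k \<or> int n dvd int j - int i + int k)}"

text \<open>\<open>lam j\<close> plays the role of the eigenvalues of a circulant feasible matrix; no symmetry
  \<open>lam j = lam (n - j)\<close> is imposed.\<close>

definition spectral_feasible :: "nat \<Rightarrow> nat set \<Rightarrow> (nat \<Rightarrow> real) set" where
  "spectral_feasible n S = {lam. (\<forall>j<n. 0 \<le> lam j) \<and> (\<Sum>j<n. lam j) = 1 \<and>
     (\<forall>k\<in>S. (\<Sum>j<n. lam j * cw n (int j * int k)) = 0)}"

lemma circ_graph_loopless:
  assumes "S \<subseteq> {1..<n}"
  shows "circ_graph n S \<subseteq> {..<n} \<times> {..<n}" "irrefl (circ_graph n S)"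
  using assms zdvd_imp_le[of "int n"]
  by (fastforce simp: circ_graph_def irrefl_def)+

text \<open>The witness consists of the eigenvalues of the average of \<open>X\<close> over cyclic
  shifts, that is, of the quadratic form of \<open>X\<close> at the Fourier vectors divided by
  \<open>n\<close>.\<close>

lemma spectral_of_theta_feasible:
  assumes n: "0 < n" and X: "X \<in> theta_feasible n (circ_graph n S)"
  shows "\<exists>lam \<in> spectral_feasible n S. (\<Sum>i<n. \<Sum>j<n. X $$ (i, j)) = real n * lam 0"
proof -
  define lam where "lam = (\<lambda>j. (\<Sum>i<n. \<Sum>l<n. X $$ (i, l) * cw n (int j * (int l - int i))) / real n)"
  have tr: "(\<Sum>i<n. X $$ (i, i)) = 1"
    and q: "\<And>f. 0 \<le> (\<Sum>i<n. \<Sum>j<n. f i * X $$ (i, j) * f j)"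
    and z: "\<And>i l. (i, l) \<in> circ_graph n S \<Longrightarrow> X $$ (i, l) = 0"
    using X by (auto simp: theta_feasible_def psd_mat_iff)
  have nonneg: "0 \<le> lam j" for j
  proof -
    have "(\<Sum>i<n. \<Sum>l<n. X $$ (i, l) * cw n (int j * (int l - int i))) =
      (\<Sum>i<n. \<Sum>l<n. cw n (int j * int i) * X $$ (i, l) * cw n (int j * int l)) +
      (\<Sum>i<n. \<Sum>l<n. sw n (int j * int i) * X $$ (i, l) * sw n (int j * int l))"
      by (simp add: right_diff_distrib cw_diff sum.distrib[symmetric] algebra_simps)
    then show ?thesis
      using q by (simp add: lam_def)
  qed
  \<comment> \<open>Orthogonality: the transform of \<open>lam\<close> at \<open>k\<close> collects
    the entries of \<open>X\<close> on the cyclic diagonals \<open>k\<close> and \<open>- k\<close>.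
    For \<open>k\<close> in \<open>S\<close> these are edges; for \<open>k = 0\<close> they form the
    trace.\<close>
  have swap: "(\<Sum>j<n. lam j * cw n (int j * k)) =
    (\<Sum>i<n. \<Sum>l<n. X $$ (i, l) * ((of_bool (int n dvd int l - int i - k) + of_bool (int n dvd int l - int i + k)) / 2))" for k
  proof -
    have "(\<Sum>j<n. lam j * cw n (int j * k)) =
      (\<Sum>j<n. \<Sum>i<n. \<Sum>l<n. X $$ (i, l) / real n * (cw n (int j * (int l - int i)) * cw n (int j * k)))"
      by (simp add: lam_def sum_distrib_right sum_distrib_left sum_divide_distrib mult.assoc)
    also have "\<dots> = (\<Sum>i<n. \<Sum>l<n. X $$ (i, l) / real n * (\<Sum>j<n. cw n (int j * (int l - int i)) * cw n (int j * k)))"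
      by (subst sum_rotate) (simp add: sum_distrib_left)
    finally show ?thesis
      using n by (simp add: sum_cw_mult_cw)
  qed
  have zero: "(\<Sum>j<n. lam j * cw n (int j * int k)) = 0" if "k \<in> S" for k
    unfolding swap
  proof (intro sum.neutral ballI)
    fix i l assume "i \<in> {..<n}" "l \<in> {..<n}"
    then show "X $$ (i, l) * ((of_bool (int n dvd int l - int i - int k) + of_bool (int n dvd int l - int i + int k)) / 2) = 0"
      using that z[of i l] by (auto simp: circ_graph_def)
  qed
  have one: "(\<Sum>j<n. lam j) = 1"
  proof -
    have "(\<Sum>j<n. lam j) = (\<Sum>i<n. \<Sum>l<n. X $$ (i, l) * of_bool (int n dvd int l - int i))"
      using swap[of 0] by simp
    also have "\<dots> = (\<Sum>i<n. \<Sum>l<n. if l = i then X $$ (i, l) else 0)"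
    proof (intro sum.cong refl)
      fix i l assume "i \<in> {..<n}" "l \<in> {..<n}"
      then have "int n dvd int l - int i \<longleftrightarrow> l = i"
        by (simp add: dvd_diff_less_iff)
      then show "X $$ (i, l) * of_bool (int n dvd int l - int i) = (if l = i then X $$ (i, l) else 0)"
        by simp
    qed
    finally show ?thesis using tr by simp
  qed
  have "(\<Sum>i<n. \<Sum>j<n. X $$ (i, j)) = real n * lam 0"
    using n by (simp add: lam_def)
  moreover have "lam \<in> spectral_feasible n S"
    using nonneg zero one by (auto simp: spectral_feasible_def)
  ultimately show ?thesis by blast
qed

text \<open>The witness is the circulant matrix whose first row is the cosine transform of
  \<open>lam\<close> divided by \<open>n\<close>, a nonnegative combination of the kernels in
  \<open>quadratic_form_cw\<close>.\<close>

lemma theta_of_spectral_feasible: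
  assumes n: "0 < n" and lam: "lam \<in> spectral_feasible n S"
  shows "\<exists>X \<in> theta_feasible n (circ_graph n S). (\<Sum>i<n. \<Sum>j<n. X $$ (i, j)) = real n * lam 0"
proof -
  define c where "c = (\<lambda>k::int. (\<Sum>j<n. lam j * cw n (int j * k)))"
  define X where "X = mat n n (\<lambda>(i, l). c (int l - int i) / real n)"
  have nonneg: "\<And>j. j < n \<Longrightarrow> 0 \<le> lam j" and one: "(\<Sum>j<n. lam j) = 1"
    and zero: "\<And>k. k \<in> S \<Longrightarrow> c (int k) = 0"
    using lam by (auto simp: spectral_feasible_def c_def)
  have c_cong: "c x = c y" if "int n dvd x - y" for x y
  proof -
    have "int n dvd int j * x - int j * y" for j
      using that by (simp flip: right_diff_distrib)
    then show ?thesis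
      unfolding c_def by (intro sum.cong refl arg_cong2[of _ _ _ _ "(*)"] cw_eqI)
  qed
  have c_minus: "c (- x) = c x" for x
    by (simp add: c_def)
  have c_sym: "c (x - y) = c (y - x)" for x y
    using c_minus[of "x - y"] by simp
  have q: "0 \<le> (\<Sum>i<n. \<Sum>l<n. f i * X $$ (i, l) * f l)" for f
  proof -
    have "(\<Sum>i<n. \<Sum>l<n. f i * X $$ (i, l) * f l) =
      (\<Sum>i<n. \<Sum>l<n. \<Sum>j<n. lam j / real n * (f i * f l * cw n (int j * int l - int j * int i)))"
      by (simp add: X_def c_def sum_distrib_left sum_distrib_right sum_divide_distrib algebra_simps)
    also have "\<dots> = (\<Sum>j<n. lam j / real n * (\<Sum>i<n. \<Sum>l<n. f i * f l * cw n (int j * int l - int j * int i)))"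
      unfolding sum_distrib_left
      by (rule sum_rotate[symmetric])
    also have "\<dots> \<ge> 0"
      by (intro sum_nonneg mult_nonneg_nonneg quadratic_form_cw_nonneg) (simp add: nonneg)
    finally show ?thesis .
  qed
  have "X $$ (i, l) = 0" if "(i, l) \<in> circ_graph n S" for i l
  proof -
    from that obtain k where k: "k \<in> S" "i < n" "l < n"
      "int n dvd int l - int i - int k \<or> int n dvd int l - int i + int k"
      by (auto simp: circ_graph_def)
    then have "c (int l - int i) = c (int k) \<or> c (int l - int i) = c (- int k)"
      using c_cong[of "int l - int i" "int k"] c_cong[of "int l - int i" "- int k"] by auto
    then show ?thesis
      using k zero by (auto simp: X_def c_minus)
  qed
  moreover have "(\<Sum>i<n. X $$ (i, i)) = 1"
    using n one by (simp add: X_def c_def)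
  ultimately have "X \<in> theta_feasible n (circ_graph n S)"
    using q by (auto simp: theta_feasible_def psd_mat_iff) (auto simp: X_def c_sym)
  moreover have "(\<Sum>i<n. \<Sum>l<n. X $$ (i, l)) = real n * lam 0"
  proof -
    \<comment> \<open>The all-ones vector is orthogonal to every nonconstant Fourier vector, so only
      frequency \<open>0\<close> survives.\<close>
    have *: "(\<Sum>i<n. \<Sum>l<n. cw n (int j * int l - int j * int i)) = (if j = 0 then (real n)\<^sup>2 else 0)"
      if "j < n" for j
    proof -
      have "(\<Sum>i<n. \<Sum>l<n. cw n (int j * int l - int j * int i)) =
          (\<Sum>i<n. cw n (int i * int j))\<^sup>2 + (\<Sum>i<n. sw n (int i * int j))\<^sup>2"
        using quadratic_form_cw[of "\<lambda>_. 1" n "\<lambda>l. int j * int l" "{..<n}"] by (simp add: mult.commute)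
      also have "\<dots> = (if j = 0 then (real n)\<^sup>2 else 0)"
        using that n dvd_imp_le[of n j] by (auto simp: sum_cw sum_sw)
      finally show ?thesis .
    qed
    have "(\<Sum>i<n. \<Sum>l<n. X $$ (i, l)) =
        (\<Sum>i<n. \<Sum>l<n. \<Sum>j<n. lam j / real n * cw n (int j * int l - int j * int i))"
      by (simp add: X_def c_def sum_divide_distrib algebra_simps)
    also have "\<dots> = (\<Sum>j<n. lam j / real n * (\<Sum>i<n. \<Sum>l<n. cw n (int j * int l - int j * int i)))"
      unfolding sum_distrib_left by (rule sum_rotate[symmetric])
    also have "\<dots> = (\<Sum>j<n. if j = 0 then real n * lam 0 else 0)"
      by (intro sum.cong refl) (simp add: * power2_eq_square)
    also have "\<dots> = real n * lam 0"
      using n by simp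
    finally show ?thesis .
  qed
  ultimately show ?thesis by blast
qed

lemma circ_theta_ge:
  assumes n: "0 < n" and S: "S \<subseteq> {1..<n}" and lam: "lam \<in> spectral_feasible n S"
  shows "real n * lam 0 \<le> lovasz_theta n (circ_graph n S)"
  using theta_of_spectral_feasible[OF n lam] lovasz_theta_is_max[OF n circ_graph_loopless[OF S]]
  by force

lemma circ_theta_attained:
  assumes n: "0 < n" and S: "S \<subseteq> {1..<n}"
  shows "\<exists>lam \<in> spectral_feasible n S. lovasz_theta n (circ_graph n S) = real n * lam 0"
  using spectral_of_theta_feasible[OF n] lovasz_theta_is_max[OF n circ_graph_loopless[OF S]]
  by force

section \<open>Duality with the complementary graph\<close>

text \<open>The uniform spectrum, which belongs to the matrix \<open>I / n\<close>, is feasible with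
  value \<open>1\<close>.\<close>

lemma circ_theta_ge_1:
  assumes n: "0 < n" and S: "S \<subseteq> {1..<n}"
  shows "1 \<le> lovasz_theta n (circ_graph n S)"
proof -
  have "\<not> int n dvd int k" if "k \<in> S" for k
    using that S zdvd_imp_le[of "int n" "int k"] by auto
  then have "(\<lambda>_. 1 / real n) \<in> spectral_feasible n S"
    using n by (simp add: spectral_feasible_def sum_cw flip: sum_divide_distrib)
  from circ_theta_ge[OF n S this] n show ?thesis by simp
qed

text \<open>Prescribe \<open>lam 0 = \<alpha>\<close> beyond the optimum and minimise the total violation of the
  constraints: the first-order conditions at the (positive) minimum yield the dual solution.\<close>

lemma circ_theta_complement_ge:
  fixes \<alpha> :: real
  assumes n: "n = 2 * m + 1" and S: "S \<subseteq> {1..m}"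
    and \<alpha>: "lovasz_theta n (circ_graph n S) < real n * \<alpha>" "\<alpha> < 1"
  shows "1 / \<alpha> \<le> lovasz_theta n (circ_graph n ({1..m} - S))"
proof -
  define c where "c = (\<lambda>lam k. \<Sum>j<n. lam j * cw n (int j * int k))"
  \<comment> \<open>Coordinates from \<open>n\<close> on are pinned to \<open>0\<close>, so the box
    is a compact product over all naturals.\<close>
  define B where "B = Pi\<^sub>E UNIV (\<lambda>j. if j = 0 then {\<alpha>} else if j < n then {0..1::real} else {0})"
  define K where "K = B \<inter> {lam. (\<Sum>j<n. lam j) = 1}"
  define Q where "Q = (\<lambda>lam. \<Sum>k\<in>S. (c lam k)\<^sup>2)"
  have npos: "0 < n" using n by simp
  have S': "S \<subseteq> {1..<n}" "{1..m} - S \<subseteq> {1..<n}" using S n by auto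
  have finS: "finite S" using S finite_subset by blast
  have n\<alpha>: "1 < real n * \<alpha>"
    using circ_theta_ge_1[OF npos S'(1)] \<alpha>(1) by simp
  then have "0 < real n * \<alpha>" by simp
  then have \<alpha>0: "0 < \<alpha>"
    by (simp add: zero_less_mult_iff)
  have n2: "1 < n"
  proof (rule ccontr)
    assume "\<not> 1 < n"
    then have "real n * \<alpha> \<le> \<alpha>" using \<alpha>0 by simp
    then show False using n\<alpha> \<alpha>(2) by simp
  qed
  have coord: "continuous_on A (\<lambda>f :: nat \<Rightarrow> real. f p)" for A p
    by (rule continuous_on_subset[OF continuous_on_product_coordinates]) simp
  have "compactin (product_topology (\<lambda>_. euclidean) UNIV) B"
    unfolding B_def by (subst compactin_PiE) auto
  then have "compact B" by (simp add: euclidean_product_topology)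
  then have "compact K" unfolding K_def
    by (intro compact_Int_closed closed_Collect_eq continuous_on_sum continuous_on_const coord)
  moreover have vertex: "(\<lambda>j. if j = 0 then \<alpha> else if j = i then 1 - \<alpha> else 0) \<in> K"
    if i: "0 < i" "i < n" for i
  proof -
    have "(\<Sum>j<n. if j = 0 then \<alpha> else if j = i then 1 - \<alpha> else 0) =
        (\<Sum>j\<in>{0, i}. if j = 0 then \<alpha> else if j = i then 1 - \<alpha> else 0)"
      using i by (intro sum.mono_neutral_right) auto
    then show ?thesis
      using i \<alpha>0 \<alpha>(2) by (auto simp: K_def B_def)
  qed
  moreover have "continuous_on K Q" unfolding Q_def c_def
    by (intro continuous_on_sum continuous_on_mult continuous_on_power continuous_on_const coord)
  ultimately obtain lam where lam: "lam \<in> K" and min: "\<And>nu. nu \<in> K \<Longrightarrow> Q lam \<le> Q nu"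
    using continuous_attains_inf[of K Q] vertex[of 1] n2 by auto
  have lam_in: "lam j \<in> (if j = 0 then {\<alpha>} else if j < n then {0..1} else {0})" for j
    using lam by (simp add: K_def B_def PiE_iff)
  have lam_ge: "0 \<le> lam j" if "j < n" for j
    using lam_in[of j] \<alpha>0 that by (simp split: if_splits)
  have lam0: "lam 0 = \<alpha>" and lam1: "(\<Sum>j<n. lam j) = 1"
    using lam lam_in[of 0] by (simp_all add: K_def)
  \<comment> \<open>A minimiser without violation would be feasible with value
    \<open>n * \<alpha>\<close>, above the optimum.\<close>
  have Qpos: "0 < Q lam"
  proof (rule ccontr)
    assume "\<not> 0 < Q lam"
    then have "Q lam = 0" by (simp add: Q_def sum_nonneg order_antisym)
    then have "\<forall>k\<in>S. c lam k = 0"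
      using finS by (simp add: Q_def sum_nonneg_eq_0_iff)
    then have "lam \<in> spectral_feasible n S"
      using lam_ge lam1 by (simp add: spectral_feasible_def c_def)
    from circ_theta_ge[OF npos S'(1) this] lam0 \<alpha>(1) show False by simp
  qed
  \<comment> \<open>Half the gradient of \<open>Q\<close> at the minimiser.\<close>
  define g where "g = (\<lambda>j. \<Sum>k\<in>S. c lam k * cw n (int j * int k))"
  have first_order: "Q lam \<le> \<alpha> * g 0 + (1 - \<alpha>) * g i" if i: "0 < i" "i < n" for i
  proof -
    define nu where "nu = (\<lambda>j. if j = 0 then \<alpha> else if j = i then 1 - \<alpha> else 0)"
    have nu: "nu \<in> K" using vertex[OF i] by (simp add: nu_def)
    define D where "D = (\<Sum>k\<in>S. c lam k * (c nu k - c lam k))"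
    define R where "R = (\<Sum>k\<in>S. (c nu k - c lam k)\<^sup>2)"
    have R0: "0 \<le> R" by (simp add: R_def sum_nonneg)
    \<comment> \<open>Along the segment from \<open>lam\<close> to the vertex \<open>nu\<close>,
      \<open>Q\<close> changes by \<open>s * (2 * D + s * R)\<close>; minimality makes this
      nonnegative.\<close>
    have step: "0 \<le> 2 * D + s * R" if s: "0 < s" "s \<le> 1" for s
    proof -
      define xi where "xi = (\<lambda>j. (1 - s) * lam j + s * nu j)"
      have "xi j \<in> (if j = 0 then {\<alpha>} else if j < n then {0..1} else {0})" for j
      proof -
        have "convex (if j = 0 then {\<alpha>} else if j < n then {0..1} else {0::real})"
          by simp
        from convexD[OF this lam_in[of j], of "nu j" "1 - s" s] nu s show ?thesis
          by (simp add: xi_def K_def B_def PiE_iff)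
      qed
      moreover have "(\<Sum>j<n. xi j) = 1"
        using lam1 nu by (simp add: xi_def K_def sum.distrib flip: sum_distrib_left)
      ultimately have "xi \<in> K"
        by (simp add: K_def B_def PiE_iff)
      have c_xi: "c xi k = c lam k + s * (c nu k - c lam k)" for k
        by (simp add: c_def xi_def sum_distrib_left sum.distrib[symmetric] sum_subtractf[symmetric] algebra_simps)
      have "Q xi = Q lam + s * (2 * D + s * R)"
        unfolding Q_def c_xi
        by (simp add: D_def R_def power2_eq_square sum_distrib_left sum.distrib[symmetric] algebra_simps)
      with min[OF \<open>xi \<in> K\<close>] s show ?thesis
        by (simp add: zero_le_mult_iff)
    qed
    have "0 \<le> D"
    proof (rule ccontr)
      assume D: "\<not> 0 \<le> D"
      \<comment> \<open>A step this short keeps \<open>s * R\<close> at most \<open>- D\<close>, so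
        the negative linear term would win.\<close>
      define s where "s = min 1 (- D / (R + 1))"
      have "s * R \<le> - D / (R + 1) * R"
        using R0 by (intro mult_right_mono) (auto simp: s_def)
      also have "\<dots> \<le> - D"
        using D R0 by (simp add: field_simps)
      finally have "2 * D + s * R < 0" using D by simp
      moreover have "0 < - D / (R + 1)" using D R0 by (intro divide_pos_pos) auto
      then have "0 < s" "s \<le> 1" by (auto simp: s_def)
      ultimately show False using step by force
    qed
    have "(\<Sum>k\<in>S. c lam k * c nu k) = \<alpha> * g 0 + (1 - \<alpha>) * g i"
    proof -
      have c_nu: "c nu k = \<alpha> * cw n 0 + (1 - \<alpha>) * cw n (int i * int k)" for k
      proof -
        have "c nu k = (\<Sum>j\<in>{0, i}. nu j * cw n (int j * int k))"
          unfolding c_def using i by (intro sum.mono_neutral_right) (auto simp: nu_def)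
        then show ?thesis using i by (simp add: nu_def)
      qed
      show ?thesis
        unfolding c_nu by (simp add: g_def sum_distrib_left sum.distrib[symmetric] algebra_simps)
    qed
    moreover have "D = (\<Sum>k\<in>S. c lam k * c nu k) - Q lam"
      by (simp add: D_def Q_def power2_eq_square sum_subtractf algebra_simps)
    ultimately show ?thesis using \<open>0 \<le> D\<close> by simp
  qed
  \<comment> \<open>The lower bound that \<open>first_order\<close> gives for \<open>g\<close> away
    from \<open>0\<close>.\<close>
  define r where "r = (Q lam - \<alpha> * g 0) / (1 - \<alpha>)"
  have r_eq: "\<alpha> * (g 0 - r) = Q lam - r"
    using \<alpha>(2) by (simp add: r_def field_simps)
  have g_ge: "r \<le> g j" if "0 < j" "j < n" for j
    using first_order[OF that] \<alpha>(2) by (simp add: r_def field_simps)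
  have sum_cw_0: "(\<Sum>j<n. cw n (int j * int k)) = 0" if "k \<in> {1..m}" for k
  proof -
    have "\<not> int n dvd int k"
      using that n zdvd_imp_le[of "int n" "int k"] by auto
    then show ?thesis by (simp add: sum_cw[OF npos])
  qed
  have sum_g: "(\<Sum>j<n. g j) = 0"
  proof -
    have "(\<Sum>j<n. g j) = (\<Sum>k\<in>S. c lam k * (\<Sum>j<n. cw n (int j * int k)))"
      unfolding g_def sum_distrib_left by (rule sum.swap)
    also have "\<dots> = 0"
      using S sum_cw_0 by (intro sum.neutral) auto
    finally show ?thesis .
  qed
  \<comment> \<open>\<open>g\<close> has mean zero and is at least \<open>r\<close> off
    \<open>0\<close>. If \<open>r \<ge> 0\<close>, then \<open>g 0 - r\<close> is at most
    \<open>- n * r\<close>, and \<open>r_eq\<close> with \<open>n * \<alpha> > 1\<close> forces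
    \<open>Q lam \<le> 0\<close>.\<close>
  have rneg: "r < 0"
  proof (rule ccontr)
    assume r: "\<not> r < 0"
    have "g 0 - r \<le> (\<Sum>j<n. g j - r)"
    proof -
      have "(\<Sum>j<n. g j - r) = (g 0 - r) + (\<Sum>j\<in>{..<n} - {0}. g j - r)"
        using npos by (subst sum.remove[of _ 0]) auto
      moreover have "0 \<le> (\<Sum>j\<in>{..<n} - {0}. g j - r)"
        using g_ge by (intro sum_nonneg) simp
      ultimately show ?thesis by simp
    qed
    also have "\<dots> = - (real n * r)"
      by (simp add: sum_subtractf sum_g)
    finally have "\<alpha> * (g 0 - r) \<le> \<alpha> * - (real n * r)"
      using \<alpha>0 by (intro mult_left_mono) auto
    then have "Q lam \<le> r * (1 - real n * \<alpha>)"
      using r_eq by (simp add: algebra_simps)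
    also have "\<dots> \<le> 0"
      using r n\<alpha> by (intro mult_nonneg_nonpos) auto
    finally show False using Qpos by simp
  qed
  \<comment> \<open>Subtracting \<open>r\<close> makes \<open>g\<close> nonnegative and affects its
    transform only at frequency \<open>0\<close>, while \<open>g\<close> itself has only frequencies
    from \<open>S\<close>. The denominator is the total mass.\<close>
  define mu where "mu = (\<lambda>j. (g j - r) / (real n * (- r)))"
  have den: "0 < real n * (- r)" using rneg npos by (simp add: mult_pos_neg)
  have mu0: "1 / \<alpha> \<le> real n * mu 0"
  proof -
    have "- r \<le> \<alpha> * (g 0 - r)" using r_eq Qpos by simp
    then have "1 / \<alpha> \<le> (g 0 - r) / (- r)"
      using rneg \<alpha>0 by (simp add: field_simps)
    also have "\<dots> = real n * mu 0"
      using npos by (simp add: mu_def)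
    finally show ?thesis .
  qed
  have "mu \<in> spectral_feasible n ({1..m} - S)"
    unfolding spectral_feasible_def mem_Collect_eq
  proof (intro conjI allI impI ballI)
    fix j assume j: "j < n"
    show "0 \<le> mu j"
    proof (cases "j = 0")
      case True
      have "0 < 1 / \<alpha>" using \<alpha>0 by simp
      with mu0 have "0 < real n * mu 0" by linarith
      then show ?thesis using True by (simp add: zero_less_mult_iff)
    next
      case False
      then show ?thesis
        unfolding mu_def using g_ge[of j] j den by (intro divide_nonneg_pos) auto
    qed
  next
    have "(\<Sum>j<n. mu j) = (\<Sum>j<n. g j - r) / (real n * (- r))"
      unfolding mu_def by (rule sum_divide_distrib[symmetric])
    also have "\<dots> = 1"
      using den rneg npos by (simp add: sum_subtractf sum_g)
    finally show "(\<Sum>j<n. mu j) = 1" .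
  next
    fix l assume l: "l \<in> {1..m} - S"
    have "(\<Sum>j<n. g j * cw n (int j * int l)) =
        (\<Sum>k\<in>S. c lam k * (\<Sum>j<n. cw n (int j * int k) * cw n (int j * int l)))"
      unfolding g_def sum_distrib_left sum_distrib_right
      by (subst sum.swap) (simp add: mult.assoc)
    also have "\<dots> = 0"
    proof (intro sum.neutral ballI)
      fix k assume k: "k \<in> S"
      then have "k \<in> {1..m}" "l \<in> {1..m}" "k \<noteq> l" using S l by auto
      \<comment> \<open>\<open>0 < k + l \<le> 2 * m < n\<close>: distinct frequencies in
        \<open>{1..m}\<close> never agree up to sign modulo \<open>n\<close>.\<close>
      then have "\<not> int n dvd int k - int l" "\<not> int n dvd int k + int l"
        using n dvd_diff_less_iff[of l n k] zdvd_imp_le[of "int n" "int k + int l"] by auto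
      then show "c lam k * (\<Sum>j<n. cw n (int j * int k) * cw n (int j * int l)) = 0"
        by (simp add: sum_cw_mult_cw[OF npos])
    qed
    finally have "(\<Sum>j<n. (g j - r) * cw n (int j * int l)) = 0"
      using sum_cw_0[of l] l by (simp add: algebra_simps sum_subtractf flip: sum_distrib_left)
    moreover have "(\<Sum>j<n. mu j * cw n (int j * int l)) =
        (\<Sum>j<n. (g j - r) * cw n (int j * int l)) / (real n * (- r))"
      unfolding mu_def times_divide_eq_left by (rule sum_divide_distrib[symmetric])
    ultimately show "(\<Sum>j<n. mu j * cw n (int j * int l)) = 0" by simp
  qed
  from circ_theta_ge[OF npos S'(2) this] mu0 show ?thesis by simp
qed

text \<open>A product below \<open>n\<close> would leave room for some \<alpha> strictly between
  \<open>?a / n\<close> and \<open>1 / ?b\<close>, contradicting the duality bound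
  \<open>1 / \<alpha> \<le> ?b\<close>.\<close>

lemma circ_theta_mult_complement_ge:
  assumes n: "n = 2 * m + 1" and S: "S \<subseteq> {1..m}"
  shows "real n \<le> lovasz_theta n (circ_graph n S) * lovasz_theta n (circ_graph n ({1..m} - S))"
    (is "_ \<le> ?a * ?b")
proof (rule ccontr)
  assume less: "\<not> real n \<le> ?a * ?b"
  have npos: "0 < n" using n by simp
  have b: "1 \<le> ?b"
    using n by (intro circ_theta_ge_1) auto
  have "?a / real n < 1 / ?b"
    using less b npos by (simp add: field_simps)
  then obtain \<alpha> where \<alpha>: "?a / real n < \<alpha>" "\<alpha> < 1 / ?b"
    using dense by blast
  have "?a < real n * \<alpha>" using \<alpha>(1) npos by (simp add: field_simps)
  moreover have "\<alpha> < 1" using \<alpha>(2) b by (smt (verit) divide_le_eq_1_pos)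
  ultimately have "1 / \<alpha> \<le> ?b"
    by (rule circ_theta_complement_ge[OF n S])
  moreover have "0 \<le> ?a / real n"
    using circ_theta_ge_1[of n S] n S by (intro divide_nonneg_nonneg) force+
  then have "0 < \<alpha>" using \<alpha>(1) by simp
  ultimately show False
    using \<alpha>(2) b by (simp add: field_simps)
qed

section \<open>Averages over random subsets\<close>

text \<open>The uniform expectation as a finite sum: linearity and independence become sum
  manipulations, free of integrability conditions.\<close>

definition avg :: "'a set \<Rightarrow> ('a set \<Rightarrow> real) \<Rightarrow> real" where
  "avg M F = (\<Sum>S\<in>Pow M. F S) / 2 ^ card M"

definition sgn_of :: "'a set \<Rightarrow> 'a \<Rightarrow> real" where
  "sgn_of S k = (if k \<in> S then 1 else - 1)"

lemma avg_mono: "(\<And>S. S \<subseteq> M \<Longrightarrow> F S \<le> G S) \<Longrightarrow> avg M F \<le> avg M G"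
  by (auto simp: avg_def intro!: divide_right_mono sum_mono)

lemma avg_cong: "(\<And>S. S \<subseteq> M \<Longrightarrow> F S = G S) \<Longrightarrow> avg M F = avg M G"
  by (auto simp: avg_def intro!: sum.cong)

lemma avg_add: "avg M (\<lambda>S. F S + G S) = avg M F + avg M G"
  by (simp add: avg_def sum.distrib add_divide_distrib)

lemma avg_cmult: "avg M (\<lambda>S. c * F S) = c * avg M F"
  by (simp add: avg_def sum_distrib_left)

lemma avg_divide: "avg M (\<lambda>S. F S / c) = avg M F / c"
  using avg_cmult[of M "inverse c" F] by (simp add: field_simps)

lemma avg_sum: "avg M (\<lambda>S. \<Sum>i\<in>I. F i S) = (\<Sum>i\<in>I. avg M (F i))"
  unfolding avg_def by (subst sum.swap) (simp add: sum_divide_distrib)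

lemma avg_const: "finite M \<Longrightarrow> avg M (\<lambda>_. c) = c"
  by (simp add: avg_def card_Pow)

lemma avg_complement:
  assumes "finite M"
  shows "avg M (\<lambda>S. F (M - S)) = avg M F"
proof -
  have "bij_betw (\<lambda>S. M - S) (Pow M) (Pow M)"
    by (rule bij_betw_byWitness[where f' = "\<lambda>S. M - S"]) auto
  from sum.reindex_bij_betw[OF this, of F] show ?thesis
    by (simp add: avg_def)
qed

lemma avg_insert:
  assumes "finite M" "a \<notin> M"
  shows "avg (insert a M) F = (avg M F + avg M (\<lambda>S. F (insert a S))) / 2"
proof -
  have inj: "inj_on (insert a) (Pow M)"
    using assms(2) by (auto simp: inj_on_def)
  have "(\<Sum>S\<in>Pow (insert a M). F S) = (\<Sum>S\<in>Pow M. F S) + (\<Sum>S\<in>insert a ` Pow M. F S)"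
    unfolding Pow_insert using assms by (intro sum.union_disjoint) auto
  also have "(\<Sum>S\<in>insert a ` Pow M. F S) = (\<Sum>S\<in>Pow M. F (insert a S))"
    by (simp add: sum.reindex[OF inj])
  finally show ?thesis
    using assms by (simp add: avg_def field_simps)
qed

text \<open>Independence of the parts of a random subset in disjoint sets, as an iterated average.
  It separates the signs in a block from those outside.\<close>

lemma avg_Un:
  assumes "finite P" "finite Q" "P \<inter> Q = {}"
  shows "avg (P \<union> Q) F = avg P (\<lambda>S. avg Q (\<lambda>T. F (S \<union> T)))"
  using assms(2,3)
proof (induction Q arbitrary: F rule: finite_induct)
  case empty
  then show ?case by (simp add: avg_const) (simp add: avg_def)
next
  case (insert a Q)
  have "avg (P \<union> insert a Q) F = (avg (P \<union> Q) F + avg (P \<union> Q) (\<lambda>S. F (insert a S))) / 2"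
    using insert assms(1) by (subst avg_insert[symmetric]) auto
  also have "\<dots> = avg P (\<lambda>S. (avg Q (\<lambda>T. F (S \<union> T)) + avg Q (\<lambda>T. F (insert a (S \<union> T)))) / 2)"
    using insert by (simp add: avg_add avg_divide)
  also have "\<dots> = avg P (\<lambda>S. avg (insert a Q) (\<lambda>T. F (S \<union> T)))"
    using insert by (simp add: avg_insert)
  finally show ?case .
qed

text \<open>Independence turns the moment generating function into a product; the cases
  \<open>x \<notin> S\<close> and \<open>x \<in> S\<close> contribute two exponentials with mean
  \<open>cosh (a x)\<close>.\<close>

lemma avg_exp_sgn:
  assumes "finite M"
  shows "avg M (\<lambda>S. exp (\<Sum>k\<in>M. sgn_of S k * a k)) = (\<Prod>k\<in>M. cosh (a k))"
  using assms
proof (induction M rule: finite_induct)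
  case empty
  then show ?case by (simp add: avg_def)
next
  case (insert x M)
  have 1: "avg M (\<lambda>S. exp (\<Sum>k\<in>insert x M. sgn_of S k * a k)) = exp (- a x) * (\<Prod>k\<in>M. cosh (a k))"
  proof -
    have "avg M (\<lambda>S. exp (\<Sum>k\<in>insert x M. sgn_of S k * a k)) =
        avg M (\<lambda>S. exp (- a x) * exp (\<Sum>k\<in>M. sgn_of S k * a k))"
    proof (rule avg_cong)
      fix S assume "S \<subseteq> M"
      then have "sgn_of S x = - 1" using insert by (auto simp: sgn_of_def)
      then show "exp (\<Sum>k\<in>insert x M. sgn_of S k * a k) = exp (- a x) * exp (\<Sum>k\<in>M. sgn_of S k * a k)"
        using insert by (simp flip: exp_add)
    qed
    then show ?thesis using insert by (simp add: avg_cmult)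
  qed
  have 2: "avg M (\<lambda>S. exp (\<Sum>k\<in>insert x M. sgn_of (insert x S) k * a k)) = exp (a x) * (\<Prod>k\<in>M. cosh (a k))"
  proof -
    have "avg M (\<lambda>S. exp (\<Sum>k\<in>insert x M. sgn_of (insert x S) k * a k)) =
        avg M (\<lambda>S. exp (a x) * exp (\<Sum>k\<in>M. sgn_of S k * a k))"
    proof (rule avg_cong)
      fix S
      have "(\<Sum>k\<in>M. sgn_of (insert x S) k * a k) = (\<Sum>k\<in>M. sgn_of S k * a k)"
        using insert by (intro sum.cong) (auto simp: sgn_of_def)
      then show "exp (\<Sum>k\<in>insert x M. sgn_of (insert x S) k * a k) = exp (a x) * exp (\<Sum>k\<in>M. sgn_of S k * a k)"
        using insert by (simp add: sgn_of_def flip: exp_add)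
    qed
    then show ?thesis using insert by (simp add: avg_cmult)
  qed
  show ?case
    unfolding avg_insert[OF insert.hyps] 1 2 using insert.hyps
    by (simp add: cosh_field_def field_simps)
qed

lemma cosh_le_exp_half_square: "cosh x \<le> exp (x\<^sup>2 / 2)" for x :: real
proof -
  define y where "y = \<bar>x\<bar>"
  \<comment> \<open>Hoeffding's lemma with probability \<open>1 / 2\<close> and parameter
    \<open>2 * y\<close>, which the absolute value makes nonnegative.\<close>
  have "- (2 * y) * (1 / 2) + ln (1 + 1 / 2 * (exp (2 * y) - 1)) \<le> (2 * y)\<^sup>2 / 8"
    by (rule Hoeffdings_lemma_aux) (simp_all add: y_def)
  then have "ln ((1 + exp (2 * y)) / 2) \<le> y + y\<^sup>2 / 2"
    by (simp add: power2_eq_square field_simps)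
  then have "(1 + exp (2 * y)) / 2 \<le> exp (y + y\<^sup>2 / 2)"
    using ln_le_cancel_iff[of "(1 + exp (2 * y)) / 2" "exp (y + y\<^sup>2 / 2)"]
    by (simp add: add_pos_pos)
  then have "exp (- y) * ((1 + exp (2 * y)) / 2) \<le> exp (- y) * exp (y + y\<^sup>2 / 2)"
    by (intro mult_left_mono) auto
  then have "cosh y \<le> exp (y\<^sup>2 / 2)"
    by (simp add: cosh_field_def field_simps flip: exp_add)
  then show ?thesis by (simp add: y_def)
qed

text \<open>Sub-Gaussian bound that serves both the second moment of \<open>excess\<close> and the
  union bound over the values of \<open>correction\<close>.\<close>

lemma avg_exp_sgn_le:
  assumes "finite M" "(\<Sum>k\<in>M. (a k)\<^sup>2) \<le> v"
  shows "avg M (\<lambda>S. exp (\<Sum>k\<in>M. sgn_of S k * a k)) \<le> exp (v / 2)"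
proof -
  have "avg M (\<lambda>S. exp (\<Sum>k\<in>M. sgn_of S k * a k)) = (\<Prod>k\<in>M. cosh (a k))"
    by (rule avg_exp_sgn) fact
  also have "\<dots> \<le> (\<Prod>k\<in>M. exp ((a k)\<^sup>2 / 2))"
    by (intro prod_mono) (simp add: cosh_le_exp_half_square)
  also have "\<dots> = exp ((\<Sum>k\<in>M. (a k)\<^sup>2) / 2)"
    using assms(1) by (simp add: exp_sum sum_divide_distrib)
  also have "\<dots> \<le> exp (v / 2)"
    using assms(2) by simp
  finally show ?thesis .
qed

section \<open>Dyadic blocks and sets whose differences avoid them\<close>

definition dyadic_block :: "nat \<Rightarrow> nat \<Rightarrow> nat set" where
  "dyadic_block m q = {k \<in> {1..m}. q \<le> k \<and> k < 2 * q}"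

text \<open>The first third of every period \<open>3 * q\<close>: differences lie at distance less
  than \<open>q\<close> from multiples of \<open>3 * q\<close> and so miss
  \<open>{q..<2 * q}\<close>.\<close>

definition sep_set :: "nat \<Rightarrow> nat \<Rightarrow> nat set" where
  "sep_set m q = {a \<in> {..m}. a mod (3 * q) < q}"

text \<open>Counts ordered pairs. These are the cosine coefficients of the squared modulus of the
  transform of \<open>A\<close>.\<close>

definition diff_count :: "nat set \<Rightarrow> nat \<Rightarrow> nat" where
  "diff_count A k = card {p \<in> A \<times> A. nat \<bar>int (fst p) - int (snd p)\<bar> = k}"

definition cos_transform :: "nat \<Rightarrow> (nat \<Rightarrow> real) \<Rightarrow> int \<Rightarrow> real" where
  "cos_transform n u k = (\<Sum>l<n. u l * cw n (int l * k))"

lemma cos_transform_abs [simp]: "cos_transform n u \<bar>k\<bar> = cos_transform n u k"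
  by (cases "0 \<le> k") (simp_all add: cos_transform_def)

text \<open>Lowering \<open>a\<close> by \<open>0\<close>, \<open>q\<close> or \<open>2 * q\<close>
  moves it into the first third of its period, so three translates of the set cover
  \<open>{..m}\<close>.\<close>

lemma card_sep_set:
  assumes "0 < q"
  shows "m + 1 \<le> 3 * card (sep_set m q)"
proof -
  let ?A = "sep_set m q"
  have fin: "finite ?A" by (simp add: sep_set_def)
  have "{..m} \<subseteq> ?A \<union> (\<lambda>a. a + q) ` ?A \<union> (\<lambda>a. a + 2 * q) ` ?A"
  proof
    fix a assume a: "a \<in> {..m}"
    define x where "x = a div (3 * q)"
    define r where "r = a mod (3 * q)"
    have ar: "a = x * (3 * q) + r" unfolding x_def r_def by (rule div_mult_mod_eq[symmetric])
    have r: "r < 3 * q" using assms by (simp add: r_def)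
    have md: "(x * (3 * q) + y) mod (3 * q) = y" if "y < 3 * q" for y
      using that by simp
    consider "r < q" | "q \<le> r" "r < 2 * q" | "2 * q \<le> r" by linarith
    then show "a \<in> ?A \<union> (\<lambda>a. a + q) ` ?A \<union> (\<lambda>a. a + 2 * q) ` ?A"
    proof cases
      case 1
      then show ?thesis using a by (simp add: sep_set_def r_def)
    next
      case 2
      then have "(x * (3 * q) + (r - q)) mod (3 * q) < q"
        using r by (subst md) auto
      then have "x * (3 * q) + (r - q) \<in> ?A"
        using a ar by (simp add: sep_set_def)
      moreover have "a = x * (3 * q) + (r - q) + q" using ar 2 by simp
      ultimately show ?thesis by blast
    next
      case 3
      then have "(x * (3 * q) + (r - 2 * q)) mod (3 * q) < q"
        using r by (subst md) auto
      then have "x * (3 * q) + (r - 2 * q) \<in> ?A"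
        using a ar by (simp add: sep_set_def)
      moreover have "a = x * (3 * q) + (r - 2 * q) + 2 * q" using ar 3 by simp
      ultimately show ?thesis by blast
    qed
  qed
  then have "card {..m} \<le> card (?A \<union> (\<lambda>a. a + q) ` ?A \<union> (\<lambda>a. a + 2 * q) ` ?A)"
    using fin by (intro card_mono) auto
  also have "\<dots> \<le> card ?A + card ((\<lambda>a. a + q) ` ?A) + card ((\<lambda>a. a + 2 * q) ` ?A)"
    using card_Un_le[of ?A "(\<lambda>a. a + q) ` ?A"]
      card_Un_le[of "?A \<union> (\<lambda>a. a + q) ` ?A" "(\<lambda>a. a + 2 * q) ` ?A"] by linarith
  also have "\<dots> \<le> card ?A + card ?A + card ?A"
    using fin by (intro add_mono card_image_le) auto
  finally show ?thesis by simp
qed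

lemma sep_set_diff_aux:
  assumes "a mod (3 * q) < q" "b mod (3 * q) < q" "b \<le> (a::nat)"
  shows "a - b < q \<or> 2 * q \<le> a - b"
proof -
  define x r y s where "x = a div (3 * q)" "r = a mod (3 * q)" "y = b div (3 * q)" "s = b mod (3 * q)"
  have a: "a = x * (3 * q) + r" and b: "b = y * (3 * q) + s"
    unfolding x_r_y_s_def by (rule div_mult_mod_eq[symmetric])+
  have rs: "r < q" "s < q" using assms by (simp_all add: x_r_y_s_def)
  have "y \<le> x" using assms(3) by (simp add: x_r_y_s_def div_le_mono)
  then consider "x = y" | "y + 1 \<le> x" by linarith
  then show ?thesis
  proof cases
    case 1
    then have "a - b < q" using a b rs by simp
    then show ?thesis ..
  next
    case 2
    then have "(y + 1) * (3 * q) \<le> x * (3 * q)" by (rule mult_le_mono1)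
    then have "y * (3 * q) + 3 * q \<le> x * (3 * q)" by (simp add: algebra_simps)
    then have "2 * q \<le> a - b" unfolding a b using rs by linarith
    then show ?thesis ..
  qed
qed

lemma diff_count_dyadic_block:
  assumes "k \<in> dyadic_block m q"
  shows "diff_count (sep_set m q) k = 0"
proof -
  have "nat \<bar>int a - int b\<bar> \<noteq> k" if "a \<in> sep_set m q" "b \<in> sep_set m q" for a b
  proof (cases "b \<le> a")
    case True
    then have "nat \<bar>int a - int b\<bar> = a - b" by simp
    then show ?thesis
      using sep_set_diff_aux[of a q b] that assms True by (auto simp: sep_set_def dyadic_block_def)
  next
    case False
    then have "nat \<bar>int a - int b\<bar> = b - a" by simp
    then show ?thesis
      using sep_set_diff_aux[of b q a] that assms False by (auto simp: sep_set_def dyadic_block_def)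
  qed
  then have "{p \<in> sep_set m q \<times> sep_set m q. nat \<bar>int (fst p) - int (snd p)\<bar> = k} = {}"
    by auto
  then show ?thesis unfolding diff_count_def by (simp only: card.empty)
qed

lemma diff_count_le:
  assumes "finite A"
  shows "diff_count A k \<le> 2 * card A"
proof -
  have "{p \<in> A \<times> A. nat \<bar>int (fst p) - int (snd p)\<bar> = k} \<subseteq>
      (\<lambda>a. (a, a + k)) ` A \<union> (\<lambda>a. (a + k, a)) ` A"
    by (auto simp: image_iff abs_if split: if_splits)
  then have "diff_count A k \<le> card ((\<lambda>a. (a, a + k)) ` A \<union> (\<lambda>a. (a + k, a)) ` A)"
    unfolding diff_count_def using assms by (intro card_mono) auto
  also have "\<dots> \<le> card ((\<lambda>a. (a, a + k)) ` A) + card ((\<lambda>a. (a + k, a)) ` A)"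
    by (rule card_Un_le)
  also have "\<dots> \<le> card A + card A"
    using assms by (intro add_mono card_image_le)
  finally show ?thesis by simp
qed

lemma diff_count_0: "diff_count A 0 = card A"
proof -
  have "{p \<in> A \<times> A. nat \<bar>int (fst p) - int (snd p)\<bar> = 0} = (\<lambda>a. (a, a)) ` A"
    by auto
  then show ?thesis
    unfolding diff_count_def by (simp add: card_image inj_on_def)
qed

text \<open>Averaging the kernel at \<open>j - l\<close> and at \<open>j + l\<close> removes the sine terms, so neither \<open>lam\<close>
  nor \<open>u\<close> has to be even.\<close>

lemma sum_mult_le_transform:
  assumes A: "A \<subseteq> {..m}" and lam: "\<And>j. j < n \<Longrightarrow> 0 \<le> lam j" and u: "\<And>j. j < n \<Longrightarrow> 0 \<le> u j"
  shows "(real (card A))\<^sup>2 * (\<Sum>j<n. lam j * u j) \<le>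
    2 * (\<Sum>k\<le>m. real (diff_count A k) * (cos_transform n lam (int k) * cos_transform n u (int k)))"
proof -
  have fin: "finite A" using A finite_subset by blast
  \<comment> \<open>The squared modulus of the transform of \<open>A\<close> at
    \<open>x\<close>.\<close>
  define kap where "kap = (\<lambda>x. \<Sum>a\<in>A. \<Sum>b\<in>A. cw n (x * int b - x * int a))"
  have kap_nonneg: "0 \<le> kap x" for x
    using quadratic_form_cw_nonneg[of "\<lambda>_. 1" n "\<lambda>a. x * int a" A] by (simp add: kap_def)
  have kap_0: "kap 0 = (real (card A))\<^sup>2"
    by (simp add: kap_def power2_eq_square)
  have kap_eq: "kap (x - y) + kap (x + y) =
      2 * (\<Sum>a\<in>A. \<Sum>b\<in>A. cw n (x * (int b - int a)) * cw n (y * (int b - int a)))" for x y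
    unfolding sum_distrib_left kap_def sum.distrib[symmetric]
    by (intro sum.cong refl) (simp add: cw_mult_cw algebra_simps)
  have "(real (card A))\<^sup>2 * (\<Sum>j<n. lam j * u j) = (\<Sum>j<n. lam j * u j * kap (int j - int j))"
    by (simp add: kap_0 sum_distrib_left mult_ac)
  \<comment> \<open>Only the diagonal \<open>l = j\<close> is kept on the left; the other terms are
    nonnegative.\<close>
  also have "\<dots> \<le> (\<Sum>j<n. \<Sum>l<n. lam j * u l * (kap (int j - int l) + kap (int j + int l)))"
  proof (intro sum_mono)
    fix j assume j: "j \<in> {..<n}"
    have "lam j * u j * kap (int j - int j) \<le> lam j * u j * (kap (int j - int j) + kap (int j + int j))"
      using j lam u kap_nonneg by (intro mult_left_mono) auto
    also have "\<dots> \<le> (\<Sum>l<n. lam j * u l * (kap (int j - int l) + kap (int j + int l)))"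
      using j lam u kap_nonneg
      by (intro member_le_sum[of j _ "\<lambda>l. lam j * u l * (kap (int j - int l) + kap (int j + int l))"])
        (auto intro!: mult_nonneg_nonneg add_nonneg_nonneg)
    finally show "lam j * u j * kap (int j - int j) \<le>
        (\<Sum>l<n. lam j * u l * (kap (int j - int l) + kap (int j + int l)))" .
  qed
  also have "\<dots> = 2 * (\<Sum>j<n. \<Sum>l<n. \<Sum>a\<in>A. \<Sum>b\<in>A.
      lam j * cw n (int j * (int b - int a)) * (u l * cw n (int l * (int b - int a))))"
    unfolding kap_eq by (simp add: sum_distrib_left mult_ac)
  also have "(\<Sum>j<n. \<Sum>l<n. \<Sum>a\<in>A. \<Sum>b\<in>A.
      lam j * cw n (int j * (int b - int a)) * (u l * cw n (int l * (int b - int a)))) =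
      (\<Sum>j<n. \<Sum>a\<in>A. \<Sum>b\<in>A. \<Sum>l<n.
      lam j * cw n (int j * (int b - int a)) * (u l * cw n (int l * (int b - int a))))"
    by (intro sum.cong[OF refl] sum_rotate)
  also have "\<dots> = (\<Sum>a\<in>A. \<Sum>b\<in>A. \<Sum>j<n. \<Sum>l<n.
      lam j * cw n (int j * (int b - int a)) * (u l * cw n (int l * (int b - int a))))"
    by (rule sum_rotate)
  also have "\<dots> = (\<Sum>a\<in>A. \<Sum>b\<in>A. cos_transform n lam (int b - int a) * cos_transform n u (int b - int a))"
    by (simp add: cos_transform_def sum_product)
  also have "\<dots> = (\<Sum>p\<in>A \<times> A. cos_transform n lam (int (snd p) - int (fst p)) * cos_transform n u (int (snd p) - int (fst p)))"
    by (simp add: sum.cartesian_product case_prod_unfold)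
  also have "\<dots> = (\<Sum>k\<le>m. \<Sum>p\<in>{p \<in> A \<times> A. nat \<bar>int (fst p) - int (snd p)\<bar> = k}.
      cos_transform n lam (int (snd p) - int (fst p)) * cos_transform n u (int (snd p) - int (fst p)))"
  proof (rule sum.group[symmetric])
    show "(\<lambda>p. nat \<bar>int (fst p) - int (snd p)\<bar>) ` (A \<times> A) \<subseteq> {..m}"
    proof
      fix k assume "k \<in> (\<lambda>p. nat \<bar>int (fst p) - int (snd p)\<bar>) ` (A \<times> A)"
      then obtain a b where "a \<in> A" "b \<in> A" "k = nat \<bar>int a - int b\<bar>" by auto
      moreover have "a \<le> m" "b \<le> m" using calculation A by auto
      ultimately show "k \<in> {..m}" by auto
    qed
  qed (use fin in auto)
  also have "\<dots> = (\<Sum>k\<le>m. real (diff_count A k) * (cos_transform n lam (int k) * cos_transform n u (int k)))"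
  proof (intro sum.cong refl)
    fix k
    have "(\<Sum>p\<in>{p \<in> A \<times> A. nat \<bar>int (fst p) - int (snd p)\<bar> = k}.
      cos_transform n lam (int (snd p) - int (fst p)) * cos_transform n u (int (snd p) - int (fst p))) =
      (\<Sum>p\<in>{p \<in> A \<times> A. nat \<bar>int (fst p) - int (snd p)\<bar> = k}. cos_transform n lam (int k) * cos_transform n u (int k))"
    proof (intro sum.cong refl)
      fix p assume "p \<in> {p \<in> A \<times> A. nat \<bar>int (fst p) - int (snd p)\<bar> = k}"
      then have "\<bar>int (snd p) - int (fst p)\<bar> = int k" by auto
      then show "cos_transform n lam (int (snd p) - int (fst p)) * cos_transform n u (int (snd p) - int (fst p)) =
          cos_transform n lam (int k) * cos_transform n u (int k)"
        by (metis cos_transform_abs)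
    qed
    then show "(\<Sum>p\<in>{p \<in> A \<times> A. nat \<bar>int (fst p) - int (snd p)\<bar> = k}.
      cos_transform n lam (int (snd p) - int (fst p)) * cos_transform n u (int (snd p) - int (fst p))) =
      real (diff_count A k) * (cos_transform n lam (int k) * cos_transform n u (int k))"
      by (simp add: diff_count_def)
  qed
  finally show ?thesis .
qed

section \<open>Sign identity, Fourier inversion and log-sum-exp for feasible spectra\<close>

lemma spectral_feasible_sgn:
  assumes "lam \<in> spectral_feasible n S"
  shows "cos_transform n lam (int k) = - (sgn_of S k * cos_transform n lam (int k))"
  \<comment> \<open>Both sides vanish for \<open>k\<close> in \<open>S\<close>, and otherwise the
    sign is \<open>- 1\<close>.\<close>
  using assms by (auto simp: spectral_feasible_def cos_transform_def sgn_of_def)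

text \<open>Fourier inversion at \<open>0\<close>: the transforms at \<open>k\<close> and
  \<open>n - k\<close> agree, and the one at \<open>0\<close> is the total mass.\<close>

lemma spectral_value_eq:
  assumes n: "n = 2 * m + 1" and lam: "(\<Sum>j<n. lam j) = 1"
  shows "real n * lam 0 = 1 + 2 * (\<Sum>k=1..m. cos_transform n lam (int k))"
proof -
  let ?c = "\<lambda>k. cos_transform n lam (int k)"
  have npos: "0 < n" using n by simp
  have "(\<Sum>k<n. ?c k) = (\<Sum>j<n. lam j * (\<Sum>k<n. cw n (int k * int j)))"
    unfolding cos_transform_def by (subst sum.swap) (simp add: sum_distrib_left mult_ac)
  also have "\<dots> = (\<Sum>j<n. if j = 0 then real n * lam j else 0)"
  proof (intro sum.cong refl)
    fix j assume "j \<in> {..<n}"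
    then have "int n dvd int j \<longleftrightarrow> j = 0"
      using zdvd_imp_le[of "int n" "int j"] by auto
    then show "lam j * (\<Sum>k<n. cw n (int k * int j)) = (if j = 0 then real n * lam j else 0)"
      by (simp add: sum_cw[OF npos])
  qed
  also have "\<dots> = real n * lam 0" using npos by simp
  finally have "real n * lam 0 = (\<Sum>k<n. ?c k)" by simp
  also have "{..<n} = insert 0 ({1..m} \<union> (\<lambda>k. n - k) ` {1..m})"
  proof -
    have "k \<in> insert 0 ({1..m} \<union> (\<lambda>k. n - k) ` {1..m})" if "k < n" for k
    proof (cases "k \<le> m")
      case False
      then have "k = n - (n - k)" "n - k \<in> {1..m}" using that n by auto
      then show ?thesis by blast
    qed auto
    moreover have "insert 0 ({1..m} \<union> (\<lambda>k. n - k) ` {1..m}) \<subseteq> {..<n}"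
      using n by auto
    ultimately show ?thesis by blast
  qed
  also have "(\<Sum>k\<in>insert 0 ({1..m} \<union> (\<lambda>k. n - k) ` {1..m}). ?c k) =
      ?c 0 + ((\<Sum>k=1..m. ?c k) + (\<Sum>k\<in>(\<lambda>k. n - k) ` {1..m}. ?c k))"
    using n by (subst sum.insert, simp, force, subst sum.union_disjoint) auto
  also have "(\<Sum>k\<in>(\<lambda>k. n - k) ` {1..m}. ?c k) = (\<Sum>k=1..m. ?c (n - k))"
    using n by (subst sum.reindex) (auto simp: inj_on_def)
  also have "\<dots> = (\<Sum>k=1..m. ?c k)"
  proof (intro sum.cong refl)
    fix k assume "k \<in> {1..m}"
    then have k: "int (n - k) = int n - int k" using n by auto
    have "cw n (int j * (int n - int k)) = cw n (int j * int k)" for j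
      using cw_eqI[of n "int j * (int n - int k)" "- (int j * int k)"] by (simp add: algebra_simps)
    then show "?c (n - k) = ?c k" unfolding k by (simp add: cos_transform_def)
  qed
  also have "?c 0 = 1" using lam by (simp add: cos_transform_def)
  finally show ?thesis by simp
qed

lemma sum_dyadic_blocks:
  "(\<Sum>i<I. \<Sum>k\<in>dyadic_block m (2 ^ i). f k) = (\<Sum>k\<in>{k \<in> {1..m}. k < 2 ^ I}. f k)"
proof (induction I)
  case 0
  have "{k \<in> {1..m}. k < 2 ^ 0} = {}" by auto
  then show ?case by (simp only: lessThan_0 sum.empty)
next
  case (Suc I)
  have "{k \<in> {1..m}. k < 2 ^ Suc I} = {k \<in> {1..m}. k < 2 ^ I} \<union> dyadic_block m (2 ^ I)"
    by (auto simp: dyadic_block_def)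
  then show ?case
    using Suc by (simp add: sum.union_disjoint[symmetric] dyadic_block_def disjoint_iff)
qed

text \<open>The log-sum-exp bound, with the logarithm replaced by its tangent at \<open>L\<close>.
  The right side is linear in the exponentials, so it can be averaged over \<open>S\<close> term by
  term.\<close>

lemma simplex_sum_le_log_sum_exp:
  fixes L t :: real and n :: nat
  assumes lam: "\<And>j. j < n \<Longrightarrow> 0 \<le> lam j" "(\<Sum>j<n. lam j) = 1" and t: "0 < t" and L: "0 < L"
  shows "(\<Sum>j<n. lam j * x j) \<le> (ln L - 1 + (\<Sum>j<n. exp (t * x j)) / L) / t"
proof -
  have le1: "lam j \<le> 1" if "j < n" for j
  proof -
    have "lam j \<le> (\<Sum>j<n. lam j)"
      using that lam(1) by (intro member_le_sum) auto
    then show ?thesis using lam(2) by simp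
  qed
  have "t * (\<Sum>j<n. lam j * x j) = (\<Sum>j<n. lam j * (t * x j))"
    by (simp add: sum_distrib_left mult_ac)
  also have "\<dots> \<le> (\<Sum>j<n. lam j * (ln L - 1 + exp (t * x j) / L))"
  proof (intro sum_mono mult_left_mono)
    fix j
    have "ln (exp (t * x j) / L) \<le> exp (t * x j) / L - 1"
      using L by (intro ln_le_minus_one) simp
    then show "t * x j \<le> ln L - 1 + exp (t * x j) / L"
      using L by (simp add: ln_div)
  qed (use lam in auto)
  also have "\<dots> = (ln L - 1) * (\<Sum>j<n. lam j) + (\<Sum>j<n. lam j * (exp (t * x j) / L))"
    unfolding distrib_left sum.distrib sum_distrib_left
    by (simp only: mult.commute[of _ "ln L - 1"])
  also have "\<dots> \<le> (ln L - 1) + (\<Sum>j<n. exp (t * x j) / L)"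
    using lam le1 L by (intro add_mono sum_mono mult_left_le_one_le) auto
  finally show ?thesis
    using t by (simp add: field_simps sum_divide_distrib)
qed

section \<open>Large values of the block sums\<close>

definition block_sum :: "nat \<Rightarrow> nat \<Rightarrow> nat \<Rightarrow> nat set \<Rightarrow> nat \<Rightarrow> real" where
  "block_sum n m q S j = (\<Sum>k\<in>dyadic_block m q. sgn_of S k * cw n (int j * int k))"

text \<open>A smooth, strictly positive majorant of the part of \<open>- block_sum\<close> above \<open>T * sqrt q\<close>;
  positivity keeps the rates \<open>correction_rate\<close> away from division by zero.\<close>

definition excess :: "nat \<Rightarrow> nat \<Rightarrow> nat \<Rightarrow> real \<Rightarrow> nat set \<Rightarrow> nat \<Rightarrow> real" where
  "excess n m q T S j = sqrt (real q) * exp (- (T / 2) * (block_sum n m q S j / sqrt (real q) + T))"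

definition l2_norm :: "nat \<Rightarrow> (nat \<Rightarrow> real) \<Rightarrow> real" where
  "l2_norm n u = sqrt (\<Sum>j<n. (u j)\<^sup>2)"

lemma l2_norm_pos:
  assumes "0 < n" "\<And>j. 0 < u j"
  shows "0 < l2_norm n u"
proof -
  have "0 < (\<Sum>j<n. (u j)\<^sup>2)"
    using assms by (intro sum_pos zero_less_power) auto
  then show ?thesis by (simp add: l2_norm_def)
qed

lemma finite_dyadic_block [simp]: "finite (dyadic_block m q)"
  by (simp add: dyadic_block_def)

lemma finite_sep_set [simp]: "finite (sep_set m q)"
  by (simp add: sep_set_def)

lemma card_dyadic_block: "card (dyadic_block m q) \<le> q"
proof -
  have "dyadic_block m q \<subseteq> {q..<2 * q}" by (auto simp: dyadic_block_def)
  then have "card (dyadic_block m q) \<le> card {q..<2 * q}" by (intro card_mono) auto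
  then show ?thesis by simp
qed

lemma excess_pos: "0 < q \<Longrightarrow> 0 < excess n m q T S j"
  by (simp add: excess_def)

text \<open>This is \<open>x \<le> exp x\<close> for \<open>x = - (T / 2) * (w + T)\<close>, where
  \<open>w\<close> is the normalised block sum; \<open>T \<ge> 2\<close> makes the factor
  \<open>2 / T\<close> at most \<open>1\<close>.\<close>

lemma neg_block_sum_le:
  assumes q: "0 < q" and T: "2 \<le> T"
  shows "- block_sum n m q S j \<le> T * sqrt (real q) + excess n m q T S j"
proof -
  define w where "w = block_sum n m q S j / sqrt (real q)"
  define x where "x = - (T / 2) * (w + T)"
  have "x \<le> exp x" using exp_ge_add_one_self[of x] by linarith
  then have "2 / T * x \<le> 2 / T * exp x"
    using T by (intro mult_left_mono) auto
  also have "\<dots> \<le> 1 * exp x"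
    using T by (intro mult_right_mono) auto
  finally have "2 / T * x \<le> exp x" by simp
  moreover have "2 / T * x = - w - T"
    using T by (simp add: x_def field_simps)
  ultimately have "- w \<le> T + exp x" by linarith
  then have "sqrt (real q) * (- w) \<le> sqrt (real q) * (T + exp x)"
    by (intro mult_left_mono) auto
  moreover have "sqrt (real q) * (- w) = - block_sum n m q S j"
    using q by (simp add: w_def)
  moreover have "excess n m q T S j = sqrt (real q) * exp x"
    by (simp add: excess_def x_def w_def)
  ultimately show ?thesis by (simp add: algebra_simps)
qed

text \<open>The squared excess is \<open>q * exp (- T^2)\<close> times the exponential of a signed
  sum of variance at most \<open>T^2\<close>, which averages to at most
  \<open>exp (T^2 / 2)\<close>.\<close>

lemma avg_l2_norm_excess:
  assumes n: "0 < n" and q: "0 < q"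
  shows "avg (dyadic_block m q) (\<lambda>S. l2_norm n (excess n m q T S))
    \<le> sqrt (real n) * sqrt (real q) * exp (- T\<^sup>2 / 4)" (is "_ \<le> ?b")
proof -
  let ?B = "dyadic_block m q"
  have bpos: "0 < ?b" using n q by simp
  have b2: "?b\<^sup>2 = real n * (real q * exp (- T\<^sup>2 / 2))"
  proof -
    have "(exp (- T\<^sup>2 / 4))\<^sup>2 = exp (- T\<^sup>2 / 2)"
      by (simp add: power2_eq_square flip: exp_add)
    then show ?thesis by (simp add: power_mult_distrib)
  qed
  have sq: "(excess n m q T S j)\<^sup>2 =
      real q * exp (- T\<^sup>2) * exp (\<Sum>k\<in>?B. sgn_of S k * (- (T / sqrt (real q)) * cw n (int j * int k)))" for S j
  proof -
    have "(\<Sum>k\<in>?B. sgn_of S k * (- (T / sqrt (real q)) * cw n (int j * int k))) =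
        - (T / sqrt (real q)) * block_sum n m q S j"
      unfolding block_sum_def sum_distrib_left by (intro sum.cong) auto
    moreover have "(exp (- (T / 2) * (block_sum n m q S j / sqrt (real q) + T)))\<^sup>2 =
        exp (- T\<^sup>2 + - (T / sqrt (real q)) * block_sum n m q S j)"
      by (simp add: power2_eq_square algebra_simps flip: exp_add)
    ultimately show ?thesis
      by (simp add: excess_def power_mult_distrib flip: exp_add)
  qed
  have var: "(\<Sum>k\<in>?B. (- (T / sqrt (real q)) * cw n (int j * int k))\<^sup>2) \<le> T\<^sup>2" for j
  proof -
    have "(\<Sum>k\<in>?B. (- (T / sqrt (real q)) * cw n (int j * int k))\<^sup>2) \<le> (\<Sum>k\<in>?B. T\<^sup>2 / real q)"
    proof (intro sum_mono)
      fix k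
      have "(cw n (int j * int k))\<^sup>2 \<le> 1"
        using abs_cw_le_1[of n "int j * int k"] by (simp add: abs_square_le_1)
      then have "T\<^sup>2 / real q * (cw n (int j * int k))\<^sup>2 \<le> T\<^sup>2 / real q * 1"
        by (intro mult_left_mono) auto
      then show "(- (T / sqrt (real q)) * cw n (int j * int k))\<^sup>2 \<le> T\<^sup>2 / real q"
        by (simp add: power_mult_distrib power_divide)
    qed
    also have "\<dots> = real (card ?B) * (T\<^sup>2 / real q)" by simp
    also have "\<dots> \<le> real q * (T\<^sup>2 / real q)"
      using card_dyadic_block[of m q] by (intro mult_right_mono) auto
    finally show ?thesis using q by simp
  qed
  have s: "avg ?B (\<lambda>S. \<Sum>j<n. (excess n m q T S j)\<^sup>2) \<le> ?b\<^sup>2"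
  proof -
    have "avg ?B (\<lambda>S. \<Sum>j<n. (excess n m q T S j)\<^sup>2) \<le> (\<Sum>j<n. real q * exp (- T\<^sup>2) * exp (T\<^sup>2 / 2))"
      unfolding avg_sum sq avg_cmult
      by (intro sum_mono mult_left_mono avg_exp_sgn_le var) auto
    also have "\<dots> = ?b\<^sup>2"
      unfolding b2 by (simp add: mult.assoc flip: exp_add)
    finally show ?thesis .
  qed
  \<comment> \<open>Linearises the square root at the target value \<open>b\<close>, in place of
    Jensen's inequality.\<close>
  have am_gm: "y \<le> inverse (2 * b) * y\<^sup>2 + b / 2" if "0 < b" for y b :: real
    using sum_squares_bound[of b y] that by (simp add: field_simps power2_eq_square)
  have "avg ?B (\<lambda>S. l2_norm n (excess n m q T S)) \<le>
      avg ?B (\<lambda>S. (inverse (2 * ?b)) * (\<Sum>j<n. (excess n m q T S j)\<^sup>2) + ?b / 2)"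
  proof (rule avg_mono)
    fix S
    define y where "y = l2_norm n (excess n m q T S)"
    have "y\<^sup>2 = (\<Sum>j<n. (excess n m q T S j)\<^sup>2)"
      by (simp add: y_def l2_norm_def sum_nonneg)
    with am_gm[OF bpos, of y]
    show "y \<le> inverse (2 * ?b) * (\<Sum>j<n. (excess n m q T S j)\<^sup>2) + ?b / 2"
      by simp
  qed
  also have "\<dots> = inverse (2 * ?b) * avg ?B (\<lambda>S. \<Sum>j<n. (excess n m q T S j)\<^sup>2) + ?b / 2"
    by (simp only: avg_add avg_cmult avg_const finite_dyadic_block)
  also have "\<dots> \<le> inverse (2 * ?b) * ?b\<^sup>2 + ?b / 2"
    using bpos by (intro add_right_mono mult_left_mono s) simp
  also have "\<dots> = ?b"
  proof -
    have "inverse (2 * b) * b\<^sup>2 + b / 2 = b" if "0 < b" for b :: real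
      using that by (simp add: power2_eq_square field_simps)
    from this[OF bpos] show ?thesis .
  qed
  finally show ?thesis .
qed

text \<open>The signed cosine sum left by the convolution of \<open>u\<close> with the kernel of
  \<open>sep_set\<close>. Frequencies in the block have coefficient zero there, so only signs
  outside it occur.\<close>

definition correction :: "nat \<Rightarrow> nat \<Rightarrow> nat \<Rightarrow> (nat \<Rightarrow> real) \<Rightarrow> nat set \<Rightarrow> nat \<Rightarrow> real" where
  "correction n m q u S j = (\<Sum>k\<in>{1..m} - dyadic_block m q. sgn_of S k *
     (real (diff_count (sep_set m q) k) * cos_transform n u (int k) * cw n (int j * int k)))"

text \<open>The exponent that optimises the exponential moment bound for \<open>correction\<close>, whose variance is
  at most the square of the denominator.\<close>

definition correction_rate :: "nat \<Rightarrow> nat \<Rightarrow> nat \<Rightarrow> (nat \<Rightarrow> real) \<Rightarrow> real" where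
  "correction_rate n m q u =
     sqrt (2 * ln (real n)) / (2 * real (card (sep_set m q)) * sqrt (real n) * l2_norm n u)"

text \<open>The log-sum-exp bound with \<open>L = n^2\<close>: there are \<open>n\<close> points,
  and each exponential moment is at most \<open>n\<close> at this rate.\<close>

definition excess_bound :: "nat \<Rightarrow> nat \<Rightarrow> nat \<Rightarrow> (nat \<Rightarrow> real) \<Rightarrow> nat set \<Rightarrow> real" where
  "excess_bound n m q u S = 2 / (real (card (sep_set m q)))\<^sup>2 *
     (real (card (sep_set m q)) * (\<Sum>j<n. u j) +
      (2 * ln (real n) - 1 +
        (\<Sum>j<n. exp (correction_rate n m q u * (- correction n m q u S j))) / (real n)\<^sup>2)
      / correction_rate n m q u)"

lemma card_sep_set_pos: "0 < q \<Longrightarrow> 0 < card (sep_set m q)"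
  using card_sep_set[of q m] by linarith

lemma correction_rate_pos:
  assumes "3 \<le> n" "0 < q" "0 < l2_norm n u"
  shows "0 < correction_rate n m q u"
  using assms card_sep_set_pos[of q m] by (simp add: correction_rate_def)

text \<open>In the transform bound, frequency \<open>0\<close> yields the mass of \<open>u\<close>
  and the block drops out; elsewhere the sign identity turns the transform of \<open>lam\<close>
  into a \<open>lam\<close>-average of signed cosines.\<close>

lemma spectral_sum_mult_le:
  assumes n: "n = 2 * m + 1" and lam: "lam \<in> spectral_feasible n S"
    and u: "\<And>j. j < n \<Longrightarrow> 0 \<le> u j"
  shows "(real (card (sep_set m q)))\<^sup>2 * (\<Sum>j<n. lam j * u j) \<le>
    2 * (real (card (sep_set m q)) * (\<Sum>j<n. u j) + (\<Sum>j<n. lam j * (- correction n m q u S j)))"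
proof -
  let ?A = "sep_set m q" and ?B = "dyadic_block m q"
  let ?c = "\<lambda>k. cos_transform n lam (int k)" and ?u = "\<lambda>k. cos_transform n u (int k)"
  let ?d = "\<lambda>k. real (diff_count ?A k)"
  have lam': "\<And>j. j < n \<Longrightarrow> 0 \<le> lam j" "(\<Sum>j<n. lam j) = 1"
    using lam by (auto simp: spectral_feasible_def)
  have "(\<Sum>k\<le>m. ?d k * (?c k * ?u k)) = ?d 0 * (?c 0 * ?u 0) + (\<Sum>k\<in>{1..m}. ?d k * (?c k * ?u k))"
  proof -
    have "{..m} = insert 0 {1..m}" by auto
    then show ?thesis by simp
  qed
  also have "?d 0 * (?c 0 * ?u 0) = real (card ?A) * (\<Sum>j<n. u j)"
    using lam' by (simp add: diff_count_0 cos_transform_def)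
  also have "(\<Sum>k\<in>{1..m}. ?d k * (?c k * ?u k)) = (\<Sum>k\<in>{1..m} - ?B. ?d k * (?c k * ?u k))"
    by (intro sum.mono_neutral_right) (auto simp: diff_count_dyadic_block)
  also have "\<dots> = (\<Sum>k\<in>{1..m} - ?B. \<Sum>j<n. lam j * (- (sgn_of S k * (?d k * ?u k * cw n (int j * int k)))))"
  proof (intro sum.cong refl)
    fix k
    have "?d k * (?c k * ?u k) = ?d k * (- (sgn_of S k * ?c k) * ?u k)"
      using spectral_feasible_sgn[OF lam, of k] by simp
    also have "\<dots> = (\<Sum>j<n. lam j * (- (sgn_of S k * (?d k * ?u k * cw n (int j * int k)))))"
      unfolding cos_transform_def[of n lam]
      by (simp add: sum_distrib_left sum_distrib_right sum_negf mult_ac)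
    finally show "?d k * (?c k * ?u k) = \<dots>" .
  qed
  also have "\<dots> = (\<Sum>j<n. lam j * (- correction n m q u S j))"
    unfolding correction_def by (subst sum.swap) (simp add: sum_distrib_left sum_negf)
  finally have "(\<Sum>k\<le>m. ?d k * (?c k * ?u k)) =
      real (card ?A) * (\<Sum>j<n. u j) + (\<Sum>j<n. lam j * (- correction n m q u S j))" .
  moreover have "?A \<subseteq> {..m}" by (auto simp: sep_set_def)
  ultimately show ?thesis
    using sum_mult_le_transform[of ?A m n lam u] lam'(1) u by simp
qed

text \<open>The right side is free of \<open>lam\<close>, so it also covers the optimal spectrum,
  which depends on \<open>S\<close>.\<close>

lemma spectral_sum_mult_le_excess_bound:
  assumes n: "n = 2 * m + 1" "3 \<le> n" and q: "0 < q" and lam: "lam \<in> spectral_feasible n S"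
    and u: "\<And>j. j < n \<Longrightarrow> 0 \<le> u j" "0 < l2_norm n u"
  shows "(\<Sum>j<n. lam j * u j) \<le> excess_bound n m q u S"
proof -
  let ?a = "real (card (sep_set m q))"
  have a: "0 < ?a" using card_sep_set_pos[OF q] by simp
  have lam': "\<And>j. j < n \<Longrightarrow> 0 \<le> lam j" "(\<Sum>j<n. lam j) = 1"
    using lam by (auto simp: spectral_feasible_def)
  have "(\<Sum>j<n. lam j * (- correction n m q u S j)) \<le>
      (ln ((real n)\<^sup>2) - 1 + (\<Sum>j<n. exp (correction_rate n m q u * (- correction n m q u S j))) / (real n)\<^sup>2)
      / correction_rate n m q u"
    using n by (intro simplex_sum_le_log_sum_exp lam' correction_rate_pos[OF n(2) q u(2)]) auto
  moreover have "ln ((real n)\<^sup>2) = 2 * ln (real n)"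
    using n by (simp add: ln_realpow)
  ultimately have le: "(\<Sum>j<n. lam j * (- correction n m q u S j)) \<le>
      (2 * ln (real n) - 1 + (\<Sum>j<n. exp (correction_rate n m q u * (- correction n m q u S j))) / (real n)\<^sup>2)
      / correction_rate n m q u" (is "_ \<le> ?R")
    by simp
  have "?a\<^sup>2 * (\<Sum>j<n. lam j * u j) \<le>
      2 * (?a * (\<Sum>j<n. u j) + (\<Sum>j<n. lam j * (- correction n m q u S j)))"
    by (rule spectral_sum_mult_le[OF n(1) lam u(1)])
  also have "\<dots> \<le> 2 * (?a * (\<Sum>j<n. u j) + ?R)"
    by (intro mult_left_mono add_left_mono le) simp
  also have "\<dots> = ?a\<^sup>2 * excess_bound n m q u S"
    unfolding excess_bound_def using a by (auto simp del: of_nat_0_less_iff)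
  finally show ?thesis
    by (rule mult_left_le_imp_le) (use a in \<open>rule zero_less_power\<close>)
qed

text \<open>Here \<open>u\<close> is fixed and only signs outside the block vary. Cauchy-Schwarz
  bounds the mass of \<open>u\<close> and Bessel the variance of \<open>correction\<close>.\<close>

lemma avg_excess_bound:
  assumes n: "n = 2 * m + 1" "3 \<le> n" and q: "0 < q" and u: "0 < l2_norm n u"
  shows "avg ({1..m} - dyadic_block m q) (excess_bound n m q u)
    \<le> 48 * sqrt (ln (real n)) / sqrt (real n) * l2_norm n u"
proof -
  let ?Q = "{1..m} - dyadic_block m q" and ?N = "l2_norm n u"
  define a where "a = real (card (sep_set m q))"
  define t where "t = correction_rate n m q u"
  define \<sigma> where "\<sigma> = 2 * a * sqrt (real n) * ?N"
  have apos: "0 < a" using card_sep_set_pos[OF q] by (simp add: a_def)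
  have an: "real n \<le> 6 * a" using card_sep_set[OF q, of m] n by (simp add: a_def)
  have \<sigma>: "0 < \<sigma>" using apos n u by (simp add: \<sigma>_def)
  have "ln 3 \<le> ln (real n)" using n by (subst ln_le_cancel_iff) auto
  then have ln1: "1 \<le> ln (real n)" using ln3_gt_1 by linarith
  have t: "t = sqrt (2 * ln (real n)) / \<sigma>" by (simp add: t_def correction_rate_def \<sigma>_def a_def)
  have tpos: "0 < t" unfolding t using \<sigma> ln1 by simp
  have t\<sigma>: "t\<^sup>2 * \<sigma>\<^sup>2 = 2 * ln (real n)"
    unfolding t using \<sigma> ln1 by (simp add: power_divide)
  have N2: "?N\<^sup>2 = (\<Sum>j<n. (u j)\<^sup>2)" by (simp add: l2_norm_def sum_nonneg)
  \<comment> \<open>The variance proxy is \<open>t^2 * \<sigma>^2 = 2 * ln n\<close>, so the moment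
    bound is \<open>exp (ln n)\<close>.\<close>
  have mgf: "avg ?Q (\<lambda>S. exp (t * (- correction n m q u S j))) \<le> real n" for j
  proof -
    define b where "b = (\<lambda>k. - t * (real (diff_count (sep_set m q) k) * cos_transform n u (int k) * cw n (int j * int k)))"
    have "(\<Sum>k\<in>?Q. (b k)\<^sup>2) \<le> (\<Sum>k\<in>?Q. (t * (2 * a))\<^sup>2 * (cos_transform n u (int k))\<^sup>2)"
    proof (intro sum_mono)
      fix k
      have "\<bar>b k\<bar> = t * real (diff_count (sep_set m q) k) * \<bar>cos_transform n u (int k)\<bar> * \<bar>cw n (int j * int k)\<bar>"
        using tpos by (simp add: b_def abs_mult)
      also have "\<dots> \<le> t * (2 * a) * \<bar>cos_transform n u (int k)\<bar> * 1"
        using tpos diff_count_le[of "sep_set m q" k] apos abs_cw_le_1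
        by (intro mult_mono) (auto simp: a_def)
      finally have "\<bar>b k\<bar>\<^sup>2 \<le> (t * (2 * a) * \<bar>cos_transform n u (int k)\<bar> * 1)\<^sup>2"
        by (intro power_mono) auto
      then show "(b k)\<^sup>2 \<le> (t * (2 * a))\<^sup>2 * (cos_transform n u (int k))\<^sup>2"
        by (simp add: power_mult_distrib)
    qed
    also have "\<dots> = (t * (2 * a))\<^sup>2 * (\<Sum>k\<in>?Q. (cos_transform n u (int k))\<^sup>2)"
      by (simp add: sum_distrib_left)
    also have "\<dots> \<le> (t * (2 * a))\<^sup>2 * (\<Sum>k<n. (cos_transform n u (int k))\<^sup>2)"
      using n by (intro mult_left_mono sum_mono2) auto
    also have "\<dots> \<le> (t * (2 * a))\<^sup>2 * (real n * ?N\<^sup>2)"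
      unfolding N2 using cw_bessel[of n u] n
      by (intro mult_left_mono) (simp_all add: cos_transform_def)
    also have "\<dots> = t\<^sup>2 * \<sigma>\<^sup>2"
      by (simp add: \<sigma>_def power_mult_distrib)
    finally have "(\<Sum>k\<in>?Q. (b k)\<^sup>2) \<le> 2 * ln (real n)" by (simp add: t\<sigma>)
    then have "avg ?Q (\<lambda>S. exp (\<Sum>k\<in>?Q. sgn_of S k * b k)) \<le> exp (2 * ln (real n) / 2)"
      by (intro avg_exp_sgn_le) auto
    moreover have "(\<Sum>k\<in>?Q. sgn_of S k * b k) = t * (- correction n m q u S j)" for S
      unfolding b_def correction_def
      by (simp add: sum_distrib_left sum_negf mult_ac)
    ultimately show ?thesis using n by simp
  qed
  have sum_u: "(\<Sum>j<n. u j) \<le> sqrt (real n) * ?N"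
  proof -
    have "(\<Sum>j<n. u j)\<^sup>2 \<le> real n * (\<Sum>j<n. (u j)\<^sup>2)"
      using sum_squared_le_sum_of_squares[of u "{..<n}"] by (simp add: mult.commute)
    then have "\<bar>\<Sum>j<n. u j\<bar> \<le> sqrt (real n * (\<Sum>j<n. (u j)\<^sup>2))"
      by (metis real_sqrt_abs real_sqrt_le_mono)
    then show ?thesis by (simp add: l2_norm_def real_sqrt_mult)
  qed
  define E where "E = (\<lambda>S. \<Sum>j<n. exp (t * (- correction n m q u S j)))"
  have "avg ?Q E \<le> (\<Sum>j<n. real n)"
    unfolding E_def avg_sum by (intro sum_mono mgf)
  then have avgE: "avg ?Q E \<le> (real n)\<^sup>2" by (simp add: power2_eq_square)
  have "excess_bound n m q u = (\<lambda>S. 2 / a\<^sup>2 * (a * (\<Sum>j<n. u j) + (2 * ln (real n) - 1) / t)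
      + 2 / a\<^sup>2 / t / (real n)\<^sup>2 * E S)"
    by (rule ext) (simp add: excess_bound_def a_def[symmetric] t_def[symmetric] E_def distrib_left add_divide_distrib)
  then have "avg ?Q (excess_bound n m q u) = 2 / a\<^sup>2 * (a * (\<Sum>j<n. u j) + (2 * ln (real n) - 1) / t)
      + 2 / a\<^sup>2 / t / (real n)\<^sup>2 * avg ?Q E"
    by (simp only: avg_add avg_cmult) (simp add: avg_const)
  also have "\<dots> \<le> 2 / a\<^sup>2 * (a * (\<Sum>j<n. u j) + (2 * ln (real n) - 1) / t)
      + 2 / a\<^sup>2 / t / (real n)\<^sup>2 * (real n)\<^sup>2"
    using avgE tpos by (intro add_left_mono mult_left_mono) auto
  \<comment> \<open>The averaged exponentials contribute at most \<open>1\<close>, which cancels the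
    \<open>- 1\<close> of the log-sum-exp bound.\<close>
  also have "\<dots> = 2 / a\<^sup>2 * (a * (\<Sum>j<n. u j) + 2 * ln (real n) / t)"
    using n by (simp add: distrib_left diff_divide_distrib right_diff_distrib)
  also have "2 * ln (real n) / t = \<sigma> * sqrt (2 * ln (real n))"
  proof -
    have "2 * ln (real n) = sqrt (2 * ln (real n)) * sqrt (2 * ln (real n))"
      using ln1 by simp
    then have "2 * ln (real n) / t = sqrt (2 * ln (real n)) * (sqrt (2 * ln (real n)) / t)"
      by (metis times_divide_eq_right)
    also have "sqrt (2 * ln (real n)) / t = \<sigma>"
      unfolding t using \<sigma> ln1 by simp
    finally show ?thesis by simp
  qed
  also have "2 / a\<^sup>2 * (a * (\<Sum>j<n. u j) + \<sigma> * sqrt (2 * ln (real n))) \<le>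
      2 / a\<^sup>2 * (a * (sqrt (real n) * ?N) + \<sigma> * sqrt (2 * ln (real n)))"
    using apos by (intro mult_left_mono add_right_mono sum_u) auto
  also have "2 / a\<^sup>2 * (a * (sqrt (real n) * ?N) + \<sigma> * sqrt (2 * ln (real n))) =
      2 * sqrt (real n) * ?N / a * (1 + 2 * sqrt (2 * ln (real n)))"
    using apos by (simp add: \<sigma>_def field_simps power2_eq_square)
  \<comment> \<open>The factor \<open>12\<close> comes from \<open>a \<ge> n / 6\<close>, the factor
    \<open>4\<close> from \<open>sqrt 2 \<le> 3 / 2\<close> and \<open>ln n \<ge> 1\<close>.\<close>
  also have "\<dots> \<le> 12 * ?N / sqrt (real n) * (4 * sqrt (ln (real n)))"
  proof (intro mult_mono)
    have "2 * sqrt (real n) * ?N / a \<le> 2 * sqrt (real n) * ?N / (real n / 6)"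
      using an apos n u by (intro divide_left_mono) auto
    also have "\<dots> = 12 * ?N / sqrt (real n)"
      using n by (simp add: field_simps)
    finally show "2 * sqrt (real n) * ?N / a \<le> 12 * ?N / sqrt (real n)" .
    have "sqrt 2 \<le> 3 / 2" by (rule real_le_lsqrt) (simp_all add: power2_eq_square)
    then have "2 * (sqrt 2 * sqrt (ln (real n))) \<le> 3 * sqrt (ln (real n))"
      using ln1 by simp
    moreover have "1 \<le> sqrt (ln (real n))" using ln1 by simp
    ultimately show "1 + 2 * sqrt (2 * ln (real n)) \<le> 4 * sqrt (ln (real n))"
      unfolding real_sqrt_mult by linarith
  qed (use u ln1 in auto)
  finally show ?thesis by (simp add: mult_ac)
qed

section \<open>Bounds for the expected theta number\<close>

text \<open>\<open>excess\<close> depends only on the signs in the block, \<open>correction\<close>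
  otherwise only on those outside. Averaging first over the outside treats \<open>excess\<close> as
  a fixed function.\<close>

lemma avg_excess_bound_excess:
  assumes n: "n = 2 * m + 1" "3 \<le> n" and q: "0 < q"
  shows "avg {1..m} (\<lambda>S. excess_bound n m q (excess n m q T S) S)
    \<le> 48 * sqrt (ln (real n)) * exp (- T\<^sup>2 / 4) * sqrt (real q)"
proof -
  let ?B = "dyadic_block m q"
  let ?K = "48 * sqrt (ln (real n)) / sqrt (real n)"
  have MB: "{1..m} = ?B \<union> ({1..m} - ?B)" by (auto simp: dyadic_block_def)
  have pos: "0 < l2_norm n (excess n m q T S)" for S
    using n excess_pos[OF q] by (intro l2_norm_pos) auto
  have split: "excess_bound n m q (excess n m q T (S \<union> S')) (S \<union> S') = excess_bound n m q (excess n m q T S) S'"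
    if "S \<subseteq> ?B" "S' \<subseteq> {1..m} - ?B" for S S'
  proof -
    have "excess n m q T (S \<union> S') = excess n m q T S"
      unfolding excess_def block_sum_def
      by (intro ext arg_cong[where f = "\<lambda>s. sqrt (real q) * exp (- (T / 2) * (s / sqrt (real q) + T))"] sum.cong)
        (use that in \<open>auto simp: sgn_of_def\<close>)
    moreover have "correction n m q u (S \<union> S') j = correction n m q u S' j" for u j
      unfolding correction_def
      by (intro sum.cong) (use that in \<open>auto simp: sgn_of_def\<close>)
    ultimately show ?thesis by (simp add: excess_bound_def)
  qed
  have "avg {1..m} (\<lambda>S. excess_bound n m q (excess n m q T S) S) =
      avg ?B (\<lambda>S. avg ({1..m} - ?B) (\<lambda>S'. excess_bound n m q (excess n m q T (S \<union> S')) (S \<union> S')))"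
    by (subst MB, rule avg_Un) auto
  also have "\<dots> = avg ?B (\<lambda>S. avg ({1..m} - ?B) (\<lambda>S'. excess_bound n m q (excess n m q T S) S'))"
    by (intro avg_cong split)
  also have "\<dots> \<le> avg ?B (\<lambda>S. ?K * l2_norm n (excess n m q T S))"
    using avg_excess_bound[OF n q pos] by (intro avg_mono) simp
  also have "\<dots> = ?K * avg ?B (\<lambda>S. l2_norm n (excess n m q T S))"
    by (rule avg_cmult)
  also have "\<dots> \<le> ?K * (sqrt (real n) * sqrt (real q) * exp (- T\<^sup>2 / 4))"
    using n q by (intro mult_left_mono avg_l2_norm_excess) auto
  also have "\<dots> = 48 * sqrt (ln (real n)) * exp (- T\<^sup>2 / 4) * sqrt (real q)"
    using n by simp
  finally show ?thesis .
qed

text \<open>Holds for every \<open>S\<close>: the sign identity makes each block of the inversion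
  formula a \<open>lam\<close>-average of \<open>- block_sum\<close>, to which the majorant
  applies.\<close>

lemma circ_theta_le:
  assumes n: "n = 2 * m + 1" "3 \<le> n" and S: "S \<subseteq> {1..m}" and T: "2 \<le> T" and I: "m < 2 ^ I"
  shows "lovasz_theta n (circ_graph n S) \<le>
    1 + 2 * (\<Sum>i<I. T * sqrt (real (2 ^ i)) + excess_bound n m (2 ^ i) (excess n m (2 ^ i) T S) S)"
proof -
  have S': "S \<subseteq> {1..<n}" using S n by auto
  obtain lam where lam: "lam \<in> spectral_feasible n S" and th: "lovasz_theta n (circ_graph n S) = real n * lam 0"
    using circ_theta_attained[OF _ S'] n by auto
  have lam': "\<And>j. j < n \<Longrightarrow> 0 \<le> lam j" "(\<Sum>j<n. lam j) = 1"
    using lam by (auto simp: spectral_feasible_def)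
  have block: "(\<Sum>k\<in>dyadic_block m q. cos_transform n lam (int k)) \<le>
      T * sqrt (real q) + excess_bound n m q (excess n m q T S) S" if q: "0 < q" for q
  proof -
    have "(\<Sum>k\<in>dyadic_block m q. cos_transform n lam (int k)) =
        (\<Sum>k\<in>dyadic_block m q. - (sgn_of S k * cos_transform n lam (int k)))"
      by (intro sum.cong refl spectral_feasible_sgn[OF lam])
    also have "\<dots> = (\<Sum>k\<in>dyadic_block m q. \<Sum>j<n. lam j * (- (sgn_of S k * cw n (int j * int k))))"
      by (simp add: cos_transform_def sum_distrib_left sum_negf mult_ac)
    also have "\<dots> = (\<Sum>j<n. lam j * (- block_sum n m q S j))"
      unfolding block_sum_def by (subst sum.swap) (simp add: sum_distrib_left sum_negf)
    also have "\<dots> \<le> (\<Sum>j<n. lam j * (T * sqrt (real q) + excess n m q T S j))"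
      using lam'(1) by (intro sum_mono mult_left_mono neg_block_sum_le[OF q T]) auto
    also have "\<dots> = T * sqrt (real q) * (\<Sum>j<n. lam j) + (\<Sum>j<n. lam j * excess n m q T S j)"
      unfolding distrib_left sum.distrib sum_distrib_left by (simp only: mult_ac)
    also have "\<dots> \<le> T * sqrt (real q) * 1 + excess_bound n m q (excess n m q T S) S"
    proof (intro add_mono spectral_sum_mult_le_excess_bound[OF n q lam])
      show "0 < l2_norm n (excess n m q T S)"
        using n excess_pos[OF q] by (intro l2_norm_pos) auto
    qed (use lam' excess_pos[OF q] in \<open>auto simp: less_imp_le\<close>)
    finally show ?thesis by simp
  qed
  have "{k \<in> {1..m}. k < 2 ^ I} = {1..m}" using I by auto
  then have "(\<Sum>k=1..m. cos_transform n lam (int k)) =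
      (\<Sum>i<I. \<Sum>k\<in>dyadic_block m (2 ^ i). cos_transform n lam (int k))"
    by (simp only: sum_dyadic_blocks)
  also have "\<dots> \<le> (\<Sum>i<I. T * sqrt (real (2 ^ i)) + excess_bound n m (2 ^ i) (excess n m (2 ^ i) T S) S)"
    by (intro sum_mono block) simp
  finally show ?thesis
    unfolding th spectral_value_eq[OF n(1) lam'(2)] by linarith
qed

lemma sum_sqrt_powers_le: "(\<Sum>i<I. sqrt (real (2 ^ i))) \<le> 3 * sqrt (real (2 ^ I))"
proof (induction I)
  case (Suc I)
  \<comment> \<open>The induction step needs \<open>1 + 3 \<le> 3 * sqrt 2\<close>.\<close>
  have "4 / 3 \<le> sqrt 2" by (rule real_le_rsqrt) (simp add: power2_eq_square)
  then have "4 * sqrt (real (2 ^ I)) \<le> 3 * (sqrt 2 * sqrt (real (2 ^ I)))"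
    by simp
  also have "\<dots> = 3 * sqrt (real (2 ^ Suc I))"
    by (simp add: real_sqrt_mult)
  finally show ?case using Suc by simp
qed simp

text \<open>By the last hypothesis the tail factor absorbs the \<open>sqrt (ln n)\<close> of the
  union bound, so a block costs at most \<open>(T + 48) * sqrt q\<close>.\<close>

lemma avg_circ_theta_le:
  assumes n: "n = 2 * m + 1" "3 \<le> n" and T: "2 \<le> T" and T': "sqrt (ln (real n)) * exp (- T\<^sup>2 / 4) \<le> 1"
  shows "avg {1..m} (\<lambda>S. lovasz_theta n (circ_graph n S)) \<le> 1 + 6 * (T + 48) * sqrt (real n)"
proof -
  have m: "1 \<le> m" using n by simp
  \<comment> \<open>Twice the largest power of two up to \<open>m\<close> exceeds \<open>m\<close>
    but not \<open>n\<close>: the blocks cover \<open>{1..m}\<close> and their scales sum to order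
    \<open>sqrt n\<close>.\<close>
  obtain i where i: "2 ^ i \<le> m" "m < 2 ^ (i + 1)"
    using ex_power_ivl1[of 2 m] m by auto
  define I where "I = i + 1"
  have I: "m < 2 ^ I" "2 ^ I \<le> n" using i n by (auto simp: I_def)
  have fin: "finite {1..m}" by simp
  have "avg {1..m} (\<lambda>S. lovasz_theta n (circ_graph n S)) \<le>
     avg {1..m} (\<lambda>S. 1 + 2 * (\<Sum>i<I. T * sqrt (real (2 ^ i)) + excess_bound n m (2 ^ i) (excess n m (2 ^ i) T S) S))"
    by (intro avg_mono circ_theta_le[OF n _ T I(1)])
  also have "\<dots> = 1 + 2 * (\<Sum>i<I. T * sqrt (real (2 ^ i)) +
      avg {1..m} (\<lambda>S. excess_bound n m (2 ^ i) (excess n m (2 ^ i) T S) S))"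
    by (simp only: avg_add avg_cmult avg_sum avg_const[OF fin])
  also have "\<dots> \<le> 1 + 2 * (\<Sum>i<I. (T + 48) * sqrt (real (2 ^ i)))"
  proof (intro add_left_mono mult_left_mono sum_mono)
    fix i
    have "avg {1..m} (\<lambda>S. excess_bound n m (2 ^ i) (excess n m (2 ^ i) T S) S) \<le>
        48 * sqrt (ln (real n)) * exp (- T\<^sup>2 / 4) * sqrt (real (2 ^ i))"
      by (rule avg_excess_bound_excess[OF n]) simp
    also have "\<dots> = 48 * ((sqrt (ln (real n)) * exp (- T\<^sup>2 / 4)) * sqrt (real (2 ^ i)))"
      by simp
    also have "\<dots> \<le> 48 * (1 * sqrt (real (2 ^ i)))"
      by (intro mult_left_mono mult_right_mono T') auto
    finally show "T * sqrt (real (2 ^ i)) + avg {1..m} (\<lambda>S. excess_bound n m (2 ^ i) (excess n m (2 ^ i) T S) S)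
        \<le> (T + 48) * sqrt (real (2 ^ i))"
      by (simp add: algebra_simps)
  qed simp
  also have "\<dots> = 1 + 2 * ((T + 48) * (\<Sum>i<I. sqrt (real (2 ^ i))))"
    by (simp only: sum_distrib_left)
  also have "\<dots> \<le> 1 + 2 * ((T + 48) * (3 * sqrt (real n)))"
  proof (intro add_left_mono mult_left_mono order_trans[OF sum_sqrt_powers_le])
    have "real (2 ^ I) \<le> real n" using I(2) by (rule of_nat_mono)
    then show "sqrt (real (2 ^ I)) \<le> sqrt (real n)" by (rule real_sqrt_le_mono)
  qed (use T in auto)
  finally show ?thesis by (simp add: mult_ac)
qed

lemma avg_circ_theta_ge:
  assumes n: "n = 2 * m + 1"
  shows "sqrt (real n) \<le> avg {1..m} (\<lambda>S. lovasz_theta n (circ_graph n S))"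
proof -
  define f where "f = (\<lambda>S. lovasz_theta n (circ_graph n S))"
  have "sqrt (real n) = avg {1..m} (\<lambda>_. sqrt (real n))"
    by (simp add: avg_const)
  also have "\<dots> \<le> avg {1..m} (\<lambda>S. (f S + f ({1..m} - S)) / 2)"
  proof (rule avg_mono)
    fix S assume S: "S \<subseteq> {1..m}"
    have "1 \<le> f S" "1 \<le> f ({1..m} - S)"
      unfolding f_def using n S by (intro circ_theta_ge_1; auto)+
    then have "sqrt (f S * f ({1..m} - S)) \<le> (f S + f ({1..m} - S)) / 2"
      by (intro arith_geo_mean_sqrt) auto
    moreover have "sqrt (real n) \<le> sqrt (f S * f ({1..m} - S))"
      using circ_theta_mult_complement_ge[OF n S] by (simp add: f_def)
    ultimately show "sqrt (real n) \<le> (f S + f ({1..m} - S)) / 2" by linarith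
  qed
  also have "\<dots> = (avg {1..m} f + avg {1..m} (\<lambda>S. f ({1..m} - S))) / 2"
    by (simp only: avg_divide avg_add)
  also have "\<dots> = avg {1..m} f"
    by (simp add: avg_complement)
  finally show ?thesis by (simp add: f_def)
qed

section \<open>Identification of the random circulant model with random subsets of
  \<open>{1..m}\<close>\<close>

lemma circulant_row_nth:
  assumes n: "n = 2 * m + 1" and x: "length x = m" and d: "d < n"
  shows "circulant_row x ! d = 1 \<longleftrightarrow> (\<exists>k \<in> {k \<in> {1..m}. x ! (k - 1) = 1}. d = k \<or> d = n - k)"
proof (cases "d = 0")
  case True
  have ne: "n - k \<noteq> 0" if "k \<le> m" for k using that n by simp
  have "d \<noteq> k \<and> d \<noteq> n - k" if "k \<in> {1..m}" for k
    using that ne[of k] True by simp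
  moreover have "circulant_row x ! d \<noteq> 1" using True by (simp add: circulant_row_def)
  ultimately show ?thesis by blast
next
  case False
  define k0 where "k0 = (if d \<le> m then d else n - d)"
  have k0: "k0 \<in> {1..m}" "d = k0 \<or> d = n - k0"
    using False n d by (auto simp: k0_def)
  have unique: "k = k0" if "k \<in> {1..m}" "d = k \<or> d = n - k" for k
    using that n d by (auto simp: k0_def)
  have "circulant_row x ! d = x ! (k0 - 1)"
  proof (cases "d \<le> m")
    case True
    then have "d - 1 < m" using False by simp
    then show ?thesis
      using x False True by (simp add: circulant_row_def k0_def nth_append)
  next
    case gt: False
    \<comment> \<open>Reversal sends index \<open>d - 1 - m\<close> to \<open>n - d - 1\<close>,
      which is \<open>k0 - 1\<close>.\<close>
    then have i: "\<not> d - 1 < m" "m - Suc (d - 1 - m) = n - d - 1" "d - 1 - m < m"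
      using n d by linarith+
    have "circulant_row x ! d = (x @ rev x) ! (d - 1)"
      using False by (simp add: circulant_row_def)
    also have "\<dots> = rev x ! (d - 1 - m)"
      using i(1) x by (simp only: nth_append if_False)
    also have "\<dots> = x ! (n - d - 1)"
      using i x by (simp only: rev_nth)
    finally show ?thesis
      using gt by (simp only: k0_def if_False)
  qed
  moreover have "x ! (k0 - 1) = 1" if "k \<in> {1..m}" "x ! (k - 1) = 1" "d = k \<or> d = n - k" for k
    using unique[OF that(1,3)] that(2) by simp
  ultimately show ?thesis
    using k0 by (intro iffI; (elim bexE CollectE conjE)?; (intro bexI[of _ k0] CollectI conjI)?) simp_all
qed

lemma circulant_edges_eq_circ_graph:
  assumes n: "n = 2 * m + 1" and x: "length x = m"
  shows "circulant_edges n (circulant_row x) = circ_graph n {k \<in> {1..m}. x ! (k - 1) = 1}"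
proof -
  let ?S = "{k \<in> {1..m}. x ! (k - 1) = 1}"
  have npos: "0 < n" using n by simp
  have "i \<noteq> j \<and> circulant_row x ! ((j + n - i) mod n) = 1 \<longleftrightarrow>
      (\<exists>k\<in>?S. int n dvd int j - int i - int k \<or> int n dvd int j - int i + int k)"
    if ij: "i < n" "j < n" for i j
  proof -
    define d where "d = (j + n - i) mod n"
    have d: "d < n" using npos by (simp add: d_def)
    have "int d = (int j + int n - int i) mod int n"
      using ij by (simp add: d_def of_nat_mod of_nat_diff)
    also have "\<dots> = (int j - int i) mod int n"
      by (metis add_diff_eq diff_add_eq mod_add_self2)
    finally have "int n dvd (int j - int i) - int d"
      by (simp add: mod_eq_dvd_iff[symmetric])
    then have shift: "int n dvd int j - int i + y \<longleftrightarrow> int n dvd int d + y" for y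
      using dvd_add_right_iff[of "int n" "int j - int i - int d" "int d + y"] by (simp add: algebra_simps)
    have 1: "int n dvd int j - int i - int k \<longleftrightarrow> d = k" if "k \<in> {1..m}" for k
      using shift[of "- int k"] dvd_diff_less_iff[of k n d] d that n by simp
    have 2: "int n dvd int j - int i + int k \<longleftrightarrow> d = n - k" if k: "k \<in> {1..m}" for k
    proof -
      have eq: "int d - int (n - k) = int d + int k - int n" using k n by auto
      have "int n dvd int d + int k \<longleftrightarrow> int n dvd int d - int (n - k)"
        using dvd_add_times_triv_right_iff[of "int n" "int d + int k - int n" 1]
        unfolding eq by simp
      then show ?thesis
        using shift[of "int k"] dvd_diff_less_iff[of "n - k" n d] d k npos by auto
    qed
    \<comment> \<open>The leading \<open>0\<close> of the row excludes loops.\<close>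
    have "i \<noteq> j" if "circulant_row x ! d = 1"
    proof
      assume "i = j"
      then have "d = 0" by (simp add: d_def)
      with that show False by (simp add: circulant_row_def)
    qed
    then show ?thesis
      using circulant_row_nth[OF n x d] 1 2 unfolding d_def[symmetric] by blast
  qed
  then show ?thesis
    unfolding circulant_edges_def circ_graph_def by blast
qed

lemma expectation_dense_random_circulant:
  assumes n: "n = 2 * m + 1"
  shows "measure_pmf.expectation (dense_random_circulant n) f = avg {1..m} (\<lambda>S. f (circ_graph n S))"
proof -
  define L where "L = {x :: nat list. set x \<subseteq> {0, 1} \<and> length x = m}"
  have fin: "finite L" unfolding L_def by (rule finite_lists_length_eq) simp
  have card: "card L = 2 ^ m" unfolding L_def by (subst card_lists_length_eq) (simp_all add: numeral_2_eq_2)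
  then have ne: "L \<noteq> {}" by (auto simp: card_eq_0_iff)
  \<comment> \<open>Entry \<open>k - 1\<close> of the list decides frequency
    \<open>k\<close>.\<close>
  have bij: "bij_betw (\<lambda>x. {k \<in> {1..m}. x ! (k - 1) = 1}) L (Pow {1..m})"
  proof (rule bij_betw_byWitness[where f' = "\<lambda>S. map (\<lambda>k. if k + 1 \<in> S then 1 else 0) [0..<m]"])
    show "\<forall>x\<in>L. map (\<lambda>k. if k + 1 \<in> {k \<in> {1..m}. x ! (k - 1) = 1} then 1 else 0) [0..<m] = x"
    proof
      fix x assume x: "x \<in> L"
      show "map (\<lambda>k. if k + 1 \<in> {k \<in> {1..m}. x ! (k - 1) = 1} then 1 else 0) [0..<m] = x"
      proof (rule nth_equalityI)
        fix k assume "k < length (map (\<lambda>k. if k + 1 \<in> {k \<in> {1..m}. x ! (k - 1) = 1} then 1 else 0) [0..<m])"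
        then have "k < m" by simp
        moreover from this have "x ! k \<in> {0, 1}"
          using x nth_mem[of k x] unfolding L_def by blast
        ultimately show "map (\<lambda>k. if k + 1 \<in> {k \<in> {1..m}. x ! (k - 1) = 1} then 1 else 0) [0..<m] ! k = x ! k"
          by auto
      qed (use x in \<open>simp add: L_def\<close>)
    qed
    show "\<forall>S\<in>Pow {1..m}. {k \<in> {1..m}. map (\<lambda>k. if k + 1 \<in> S then 1 else 0) [0..<m] ! (k - 1) = (1 :: nat)} = S"
    proof
      fix S assume S: "S \<in> Pow {1..m}"
      have "map (\<lambda>k. if k + 1 \<in> S then 1 else 0) [0..<m] ! (k - 1) = (1 :: nat) \<longleftrightarrow> k \<in> S"
        if "k \<in> {1..m}" for k
      proof -
        have "k - 1 < m" "k - 1 + 1 = k" using that by auto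
        then show ?thesis by simp
      qed
      then show "{k \<in> {1..m}. map (\<lambda>k. if k + 1 \<in> S then 1 else 0) [0..<m] ! (k - 1) = (1 :: nat)} = S"
        using S by blast
    qed
  qed (auto simp: L_def)
  have "measure_pmf.expectation (dense_random_circulant n) f =
      (\<Sum>x\<in>L. f (circulant_edges n (circulant_row x))) / real (card L)"
  proof -
    have "(n - 1) div 2 = m" using n by simp
    then have "dense_random_circulant n = map_pmf (\<lambda>x. circulant_edges n (circulant_row x)) (pmf_of_set L)"
      by (simp add: dense_random_circulant_def L_def)
    then show ?thesis using fin ne by (simp add: integral_pmf_of_set)
  qed
  also have "\<dots> = (\<Sum>x\<in>L. f (circ_graph n {k \<in> {1..m}. x ! (k - 1) = 1})) / 2 ^ m"
    unfolding card using circulant_edges_eq_circ_graph[OF n] by (simp add: L_def)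
  also have "\<dots> = avg {1..m} (\<lambda>S. f (circ_graph n S))"
    using sum.reindex_bij_betw[OF bij, of "\<lambda>S. f (circ_graph n S)"] by (simp add: avg_def)
  finally show ?thesis .
qed

theorem theorem1:
  shows "\<exists>C :: real. C > 0 \<and> (\<forall>n :: nat. odd n \<longrightarrow>
     sqrt (real n) \<le> measure_pmf.expectation (dense_random_circulant n) (lovasz_theta n) \<and>
     (n \<ge> 3 \<longrightarrow>
       measure_pmf.expectation (dense_random_circulant n) (lovasz_theta n)
         \<le> C * sqrt (real n * ln (ln (real n)))))"
proof -
  have l3: "0 < ln (ln (3 :: real))"
    using ln3_gt_1 by simp
  \<comment> \<open>The second summand gives \<open>K * l \<ge> 4\<close>, hence
    \<open>T \<ge> 2\<close>, for all \<open>n \<ge> 3\<close>; \<open>K \<ge> 2\<close> gives the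
    decay \<open>exp (- T^2 / 4) \<le> 1 / sqrt (ln n)\<close>.\<close>
  define K where "K = 2 + 4 / ln (ln (3 :: real))"
  have K: "2 \<le> K" using l3 by (simp add: K_def)
  have upper: "measure_pmf.expectation (dense_random_circulant n) (lovasz_theta n)
      \<le> 295 * sqrt K * sqrt (real n * ln (ln (real n)))" if n: "n = 2 * m + 1" "3 \<le> n" for n m
  proof -
    define l where "l = ln (ln (real n))"
    have ln3: "ln 3 \<le> ln (real n)" using n by (subst ln_le_cancel_iff) auto
    then have lnn: "1 < ln (real n)" using ln3_gt_1 by linarith
    have ll: "ln (ln 3) \<le> l" unfolding l_def
      using ln3 ln3_gt_1 lnn by (subst ln_le_cancel_iff) auto
    then have l: "0 < l" using l3 by linarith
    define T where "T = sqrt (K * l)"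
    have T2: "T\<^sup>2 = K * l" using K l by (simp add: T_def)
    have "4 = 4 / ln (ln 3) * ln (ln (3 :: real))" using l3 by simp
    also have "\<dots> \<le> K * l"
      using l3 ll by (intro mult_mono) (auto simp: K_def)
    finally have "2\<^sup>2 \<le> K * l" by simp
    then have T: "2 \<le> T" unfolding T_def by (rule real_le_rsqrt)
    have "exp (- T\<^sup>2 / 4) \<le> exp (- l / 2)"
      using K l mult_right_mono[of 2 K l] by (simp add: T2)
    also have "\<dots> = 1 / sqrt (ln (real n))"
    proof -
      have "exp (l / 2) = sqrt (ln (real n))"
      proof (rule real_sqrt_unique[symmetric])
        show "(exp (l / 2))\<^sup>2 = ln (real n)"
          using lnn by (simp add: power2_eq_square l_def flip: exp_add)
      qed simp
      then show ?thesis by (simp add: exp_minus inverse_eq_divide)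
    qed
    finally have "sqrt (ln (real n)) * exp (- T\<^sup>2 / 4) \<le> sqrt (ln (real n)) * (1 / sqrt (ln (real n)))"
      using lnn by (intro mult_left_mono) auto
    then have T': "sqrt (ln (real n)) * exp (- T\<^sup>2 / 4) \<le> 1"
      using lnn by simp
    have "measure_pmf.expectation (dense_random_circulant n) (lovasz_theta n)
        \<le> 1 + 6 * (T + 48) * sqrt (real n)"
      unfolding expectation_dense_random_circulant[OF n(1)] by (rule avg_circ_theta_le[OF n T T'])
    also have "\<dots> \<le> sqrt (real n) + 6 * (T + 48) * sqrt (real n)"
      using n by simp
    \<comment> \<open>\<open>289 = 1 + 6 * 48\<close>; the next step uses
      \<open>289 \<le> 289 * T\<close>.\<close>
    also have "\<dots> = (289 + 6 * T) * sqrt (real n)" by (simp add: algebra_simps)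
    also have "\<dots> \<le> (295 * T) * sqrt (real n)"
      using T by (intro mult_right_mono) auto
    also have "\<dots> = 295 * sqrt K * sqrt (real n * l)"
      by (simp add: T_def real_sqrt_mult)
    finally show ?thesis by (simp add: l_def)
  qed
  have lower: "sqrt (real n) \<le> measure_pmf.expectation (dense_random_circulant n) (lovasz_theta n)"
    if "n = 2 * m + 1" for n m
    unfolding expectation_dense_random_circulant[OF that] by (rule avg_circ_theta_ge[OF that])
  show ?thesis
  proof (intro exI[of _ "295 * sqrt K"] conjI allI impI)
    show "0 < 295 * sqrt K" using K by simp
  next
    fix n :: nat assume "odd n"
    then obtain m where n: "n = 2 * m + 1" by (rule oddE)
    show "sqrt (real n) \<le> measure_pmf.expectation (dense_random_circulant n) (lovasz_theta n)"
      by (rule lower[OF n])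
    show "measure_pmf.expectation (dense_random_circulant n) (lovasz_theta n)
        \<le> 295 * sqrt K * sqrt (real n * ln (ln (real n)))" if "3 \<le> n"
      by (rule upper[OF n that])
  qed
qed

end
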